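(* Assume the Ultrapower Axiom. Suppose \(U_0\) and \(U_1\) are normal ultrafilters on a measurable cardinal \(\kappa\). Then \(U_0\) and \(U_1\) are Mitchell comparable, i.e. \(U_0=U_1\), or \(U_0\in\mathrm{Ult}(V,U_1)\), or \(U_1\in\mathrm{Ult}(V,U_0)\).
   Context: For a countably complete ultrafilter \(U\), \(\mathrm{Ult}(V,U)\) is the transitive collapse of the ultrapower of \(V\) by \(U\) and \(j_U\) its embedding. A comparison of \(\langle U_0,U_1\rangle\) by internal ultrafilters is a pair \(\langle W_0,W_1\rangle\) with \(W_i\in\mathrm{Ult}(V,U_i)\) and \(\mathrm{Ult}(V,U_i)\models\) "\(W_i\) is a countably complete ultrafilter", such that \(\mathrm{Ult}(\mathrm{Ult}(V,U_0),W_0)=\mathrm{Ult}(\mathrm{Ult}(V,U_1),W_1)\) and \(j_{W_0}\circ j_{U_0}=j_{W_1}\circ j_{U_1}\). The Ultrapower Axiom states that every pair of countably complete ultrafilters admits a comparison by internal ultrafilters. *)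

theory Defs
  imports Main
begin

text \<open>
  The set-theoretic universe \<open>V\<close> is an arbitrary model of first-order ZFC: a type \<open>'a\<close> in which
  \<open>elts x\<close> is the extension of the set \<open>x\<close>, so that \<open>y \<in> elts x\<close> is the membership relation of the
  model. The model need not be well-founded from the point of view of HOL, and a HOL set of elements
  of \<open>'a\<close> need not be a class of the model. As usual in ZFC, the classes are the collections that are
  first-order definable from parameters.
\<close>

class set_universe =
  fixes elts :: "'a \<Rightarrow> 'a set"

text \<open>
  Truth sets of the first-order formulas of the language of set theory; an assignment \<open>s\<close> gives
  the values of the variables \<open>v\<^sub>0, v\<^sub>1, \<dots>\<close>
\<close>

inductive definable :: "((nat \<Rightarrow> 'a::set_universe) \<Rightarrow> bool) \<Rightarrow> bool" where
  Mem: "definable (\<lambda>s. s i \<in> elts (s j))"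
| Eq: "definable (\<lambda>s. s i = s j)"
| Not: "definable P \<Longrightarrow> definable (\<lambda>s. \<not> P s)"
| And: "definable P \<Longrightarrow> definable Q \<Longrightarrow> definable (\<lambda>s. P s \<and> Q s)"
| Ex: "definable P \<Longrightarrow> definable (\<lambda>s. \<exists>x. P (s(i := x)))"

definition is_class :: "'a::set_universe set \<Rightarrow> bool" where
  "is_class A \<longleftrightarrow> (\<exists>P s. definable P \<and> A = {x. P (s(0 := x))})"

definition is_class_rel :: "('a::set_universe \<Rightarrow> 'a \<Rightarrow> bool) \<Rightarrow> bool" where
  "is_class_rel R \<longleftrightarrow> (\<exists>P s. definable P \<and> (\<forall>x y. R x y \<longleftrightarrow> P (s(0 := x, 1 := y))))"

class zfc = set_universe +
  assumes extensionality: "elts x = elts y \<Longrightarrow> x = y"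
    and foundation: "elts x \<noteq> {} \<Longrightarrow> \<exists>y\<in>elts x. elts y \<inter> elts x = {}"
    and pairing: "\<exists>z. elts z = {x, y}"
    and union: "\<exists>z. elts z = (\<Union>y\<in>elts x. elts y)"
    and powerset: "\<exists>z. elts z = {y. elts y \<subseteq> elts x}"
    and infinity: "\<exists>z. (\<exists>e\<in>elts z. elts e = {}) \<and>
          (\<forall>n\<in>elts z. \<exists>m\<in>elts z. elts m = insert n (elts n))"
    and separation: "is_class A \<Longrightarrow> \<exists>z. elts z = elts x \<inter> A"
    and replacement: "is_class_rel R \<Longrightarrow> \<forall>u\<in>elts x. \<exists>!v. R u v \<Longrightarrow>
          \<exists>z. elts z = {v. \<exists>u\<in>elts x. R u v}"
    and choice: "\<forall>u\<in>elts x. elts u \<noteq> {} \<Longrightarrow>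
          \<forall>u\<in>elts x. \<forall>v\<in>elts x. u \<noteq> v \<longrightarrow> elts u \<inter> elts v = {} \<Longrightarrow>
          \<exists>z. \<forall>u\<in>elts x. \<exists>!w. w \<in> elts z \<inter> elts u"

text \<open>\<open>set_of A\<close> is only meaningful if \<open>A\<close> is the extension of a set of the model.\<close>

definition set_of :: "'a::zfc set \<Rightarrow> 'a" where
  "set_of A = (THE x. elts x = A)"

definition opair :: "'a::zfc \<Rightarrow> 'a \<Rightarrow> 'a" where
  "opair x y = set_of {set_of {x}, set_of {x, y}}"

definition fun_on :: "'a::zfc \<Rightarrow> 'a \<Rightarrow> bool" where
  "fun_on f X \<longleftrightarrow> elts f \<subseteq> {opair x y | x y. x \<in> elts X} \<and>
     (\<forall>x\<in>elts X. \<exists>!y. opair x y \<in> elts f)"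

definition app :: "'a::zfc \<Rightarrow> 'a \<Rightarrow> 'a" where
  "app f x = (THE y. opair x y \<in> elts f)"

definition const_fun :: "'a::zfc \<Rightarrow> 'a \<Rightarrow> 'a" where
  "const_fun X a = set_of ((\<lambda>x. opair x a) ` elts X)"

definition is_inductive :: "'a::zfc \<Rightarrow> bool" where
  "is_inductive z \<longleftrightarrow> (\<exists>e\<in>elts z. elts e = {}) \<and>
     (\<forall>n\<in>elts z. \<exists>m\<in>elts z. elts m = insert n (elts n))"

text \<open>The \<open>\<omega>\<close> of the model, which may contain nonstandard numbers\<close>

definition omega :: "'a::zfc" where
  "omega = set_of {n. \<forall>z. is_inductive z \<longrightarrow> n \<in> elts z}"

definition ordinal :: "'a::zfc \<Rightarrow> bool" where
  "ordinal a \<longleftrightarrow> (\<forall>b\<in>elts a. elts b \<subseteq> elts a) \<and>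
     (\<forall>b\<in>elts a. \<forall>c\<in>elts a. b \<in> elts c \<or> b = c \<or> c \<in> elts b)"

definition cardinal :: "'a::zfc \<Rightarrow> bool" where
  "cardinal k \<longleftrightarrow> ordinal k \<and>
     \<not> (\<exists>a\<in>elts k. \<exists>f. fun_on f a \<and> bij_betw (app f) (elts a) (elts k))"

text \<open>
  The following notions are relativised to a transitive class \<open>M\<close>; the case \<open>M = UNIV\<close> is that of
  \<open>V\<close>. For \<open>X, U \<in> M\<close> they say what \<open>M\<close> satisfies about \<open>X\<close> and \<open>U\<close>. Only the quantifiers over
  arbitrary subsets of \<open>X\<close> and arbitrary functions need an explicit bound \<open>M\<close>: all others range
  over elements of sets in \<open>M\<close>, and \<open>opair\<close>, \<open>fun_on\<close>, \<open>app\<close> and \<open>omega\<close> are absolute for the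
  transitive models \<open>M\<close> of ZFC to which this is applied.
\<close>

definition ultrafilter_in :: "'a::zfc set \<Rightarrow> 'a \<Rightarrow> 'a \<Rightarrow> bool" where
  "ultrafilter_in M X U \<longleftrightarrow> X \<in> M \<and> U \<in> M \<and>
     (\<forall>A\<in>elts U. elts A \<subseteq> elts X \<and> elts A \<noteq> {}) \<and> X \<in> elts U \<and>
     (\<forall>A\<in>elts U. \<forall>B\<in>M. elts A \<subseteq> elts B \<and> elts B \<subseteq> elts X \<longrightarrow> B \<in> elts U) \<and>
     (\<forall>A\<in>elts U. \<forall>B\<in>elts U. \<exists>C\<in>elts U. elts C = elts A \<inter> elts B) \<and>
     (\<forall>A\<in>M. elts A \<subseteq> elts X \<longrightarrow> A \<in> elts U \<or> (\<exists>B\<in>elts U. elts B = elts X - elts A))"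

definition closed_under_inter_in :: "'a::zfc set \<Rightarrow> 'a \<Rightarrow> 'a \<Rightarrow> 'a \<Rightarrow> bool" where
  "closed_under_inter_in M g X U \<longleftrightarrow>
     (\<forall>s\<in>M. fun_on s g \<and> (\<forall>i\<in>elts g. app s i \<in> elts U) \<longrightarrow>
        (\<exists>A\<in>elts U. elts A = {x \<in> elts X. \<forall>i\<in>elts g. x \<in> elts (app s i)}))"

definition cc_ultrafilter_in :: "'a::zfc set \<Rightarrow> 'a \<Rightarrow> 'a \<Rightarrow> bool" where
  "cc_ultrafilter_in M X U \<longleftrightarrow> ultrafilter_in M X U \<and> closed_under_inter_in M omega X U"

text \<open>\<open>{x \<in> X. P x} \<in> U\<close>\<close>

definition almost_all :: "'a::zfc \<Rightarrow> 'a \<Rightarrow> ('a \<Rightarrow> bool) \<Rightarrow> bool" where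
  "almost_all X U P \<longleftrightarrow> (\<exists>A\<in>elts U. elts A = {x \<in> elts X. P x})"

definition funs_in :: "'a::zfc set \<Rightarrow> 'a \<Rightarrow> 'a set" where
  "funs_in M X = {f \<in> M. fun_on f X}"

text \<open>
  \<open>is_Ult M X U N \<pi>\<close>: the transitive class \<open>N\<close> is \<open>Ult(M,U)\<close>, where \<open>U\<close> is an ultrafilter on \<open>X\<close>,
  and \<open>\<pi> f\<close> is the element of \<open>N\<close> represented by the function \<open>f \<in> M\<close> on \<open>X\<close>. That is, \<open>\<pi>\<close> induces
  an isomorphism of the ultrapower, formed with the functions in \<open>M\<close>, with \<open>N\<close>. The isomorphism has
  to be a class of \<open>V\<close>, without which \<open>N\<close> would not be unique in an ill-founded model.
\<close>

definition is_Ult :: "'a::zfc set \<Rightarrow> 'a \<Rightarrow> 'a \<Rightarrow> 'a set \<Rightarrow> ('a \<Rightarrow> 'a) \<Rightarrow> bool" where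
  "is_Ult M X U N \<pi> \<longleftrightarrow>
     is_class_rel (\<lambda>f y. f \<in> funs_in M X \<and> y = \<pi> f) \<and>
     \<pi> ` funs_in M X = N \<and> (\<forall>x\<in>N. elts x \<subseteq> N) \<and>
     (\<forall>f\<in>funs_in M X. \<forall>g\<in>funs_in M X.
        (\<pi> f = \<pi> g \<longleftrightarrow> almost_all X U (\<lambda>x. app f x = app g x)) \<and>
        (\<pi> f \<in> elts (\<pi> g) \<longleftrightarrow> almost_all X U (\<lambda>x. app f x \<in> elts (app g x))))"

text \<open>The ultrapower embedding \<open>j\<^sub>U\<close>\<close>

definition ult_emb :: "'a::zfc \<Rightarrow> ('a \<Rightarrow> 'a) \<Rightarrow> 'a \<Rightarrow> 'a" where
  "ult_emb X \<pi> a = \<pi> (const_fun X a)"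

definition is_comparison ::
  "'a::zfc \<Rightarrow> 'a \<Rightarrow> 'a \<Rightarrow> 'a \<Rightarrow> 'a \<Rightarrow> 'a \<Rightarrow> 'a \<Rightarrow> 'a \<Rightarrow> bool" where
  "is_comparison X0 U0 X1 U1 Y0 W0 Y1 W1 \<longleftrightarrow>
     (\<exists>M0 \<pi>0 M1 \<pi>1 N \<rho>0 \<rho>1.
        is_Ult UNIV X0 U0 M0 \<pi>0 \<and> is_Ult UNIV X1 U1 M1 \<pi>1 \<and>
        cc_ultrafilter_in M0 Y0 W0 \<and> cc_ultrafilter_in M1 Y1 W1 \<and>
        is_Ult M0 Y0 W0 N \<rho>0 \<and> is_Ult M1 Y1 W1 N \<rho>1 \<and>
        (\<forall>a. ult_emb Y0 \<rho>0 (ult_emb X0 \<pi>0 a) = ult_emb Y1 \<rho>1 (ult_emb X1 \<pi>1 a)))"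

definition ultrapower_axiom :: "'a::zfc itself \<Rightarrow> bool" where
  "ultrapower_axiom _ \<longleftrightarrow>
     (\<forall>(X0::'a) U0 X1 U1.
        cc_ultrafilter_in UNIV X0 U0 \<and> cc_ultrafilter_in UNIV X1 U1 \<longrightarrow>
        (\<exists>Y0 W0 Y1 W1. is_comparison X0 U0 X1 U1 Y0 W0 Y1 W1))"

definition nonprincipal :: "'a::zfc \<Rightarrow> 'a \<Rightarrow> bool" where
  "nonprincipal X U \<longleftrightarrow>
     \<not> (\<exists>x\<in>elts X. elts U = {A. elts A \<subseteq> elts X \<and> x \<in> elts A})"

text \<open>
  For a cardinal \<open>k\<close>, closure under intersections of fewer than \<open>k\<close> sets is closure under
  intersections of sequences of length less than \<open>k\<close>.
\<close>

definition k_complete_ultrafilter :: "'a::zfc \<Rightarrow> 'a \<Rightarrow> bool" where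
  "k_complete_ultrafilter k U \<longleftrightarrow> ultrafilter_in UNIV k U \<and>
     (\<forall>g\<in>elts k. closed_under_inter_in UNIV g k U)"

definition measurable_cardinal :: "'a::zfc \<Rightarrow> bool" where
  "measurable_cardinal k \<longleftrightarrow> cardinal k \<and> omega \<in> elts k \<and>
     (\<exists>U. k_complete_ultrafilter k U \<and> nonprincipal k U)"

definition normal_ultrafilter :: "'a::zfc \<Rightarrow> 'a \<Rightarrow> bool" where
  "normal_ultrafilter k U \<longleftrightarrow> k_complete_ultrafilter k U \<and> nonprincipal k U \<and>
     (\<forall>s. fun_on s k \<and> (\<forall>a\<in>elts k. app s a \<in> elts U) \<longrightarrow>
        (\<exists>D\<in>elts U. elts D = {b \<in> elts k. \<forall>a\<in>elts b. b \<in> elts (app s a)}))"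

text \<open>\<open>a \<in> Ult(V,U)\<close>\<close>

definition in_Ult :: "'a::zfc \<Rightarrow> 'a \<Rightarrow> 'a \<Rightarrow> bool" where
  "in_Ult a X U \<longleftrightarrow> (\<exists>N \<pi>. is_Ult UNIV X U N \<pi> \<and> a \<in> N)"

end

(* Let k0 : M0 -> N and k1 : M1 -> N be the comparison embeddings, where Mi is the ultrapower of V by
   Ui with embedding ji, so that k0 o j0 = k1 o j1. By normality kappa is represented in Mi by the
   identity, hence A in Ui iff kappa in ji(A) iff ki(kappa) in ki(ji(A)). If k0(kappa) = k1(kappa),
   then U0 = U1. If k0(kappa) < k1(kappa), say k0(kappa) is represented by a function f in M1 modulo
   W1, then A in U0 iff f takes values in A almost everywhere with respect to W1, since
   A = j1(A) cap kappa. As M1 contains all subsets of kappa as well as f and W1, it contains U0.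
   The case k1(kappa) < k0(kappa) is symmetric. *)

theory Submission
  imports Defs
begin

section \<open>Definability with parameters\<close>

lemma definable_finite_support:
  assumes "definable P"
  shows "\<exists>N::nat. \<forall>s s'. (\<forall>i<N. s i = s' i) \<longrightarrow> P s = P s'"
  using assms
proof induction
  case (Mem i j)
  show ?case by (rule exI[of _ "Suc (max i j)"]) (auto simp: less_Suc_eq_le)
next
  case (Eq i j)
  show ?case by (rule exI[of _ "Suc (max i j)"]) (auto simp: less_Suc_eq_le)
next
  case (Not P)
  then show ?case by metis
next
  case (And P Q)
  then obtain m n where "\<forall>s s'. (\<forall>i<m. s i = s' i) \<longrightarrow> P s = P s'"
    and "\<forall>s s'. (\<forall>i<n. s i = s' i) \<longrightarrow> Q s = Q s'" by blast
  then have "\<forall>s s'. (\<forall>i<max m n. s i = s' i) \<longrightarrow> (P s \<and> Q s) = (P s' \<and> Q s')"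
    by (metis less_max_iff_disj)
  then show ?case by blast
next
  case (Ex P k)
  then obtain N where N: "\<And>s s'. (\<forall>i<N. s i = s' i) \<Longrightarrow> P s = P s'" by blast
  have "(\<exists>x. P (s(k := x))) = (\<exists>x. P (s'(k := x)))" if "\<forall>i<N. s i = s' i" for s s'
  proof -
    have "P (s(k := x)) = P (s'(k := x))" for x
      by (rule N) (use that in auto)
    then show ?thesis by simp
  qed
  then show ?case by blast
qed

lemma definable_rename: "definable P \<Longrightarrow> definable (\<lambda>s. P (\<lambda>i. s (r i)))"
proof (induction arbitrary: r rule: definable.induct)
  case (Mem i j)
  show ?case by (rule definable.Mem)
next
  case (Eq i j)
  show ?case by (rule definable.Eq)
next
  case (Not P)
  then show ?case by (intro definable.Not)
next
  case (And P Q)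
  then show ?case by (intro definable.And)
next
  case (Ex P k)
  obtain N where N: "\<And>s s'. (\<forall>i<N. s i = s' i) \<Longrightarrow> P s = P s'"
    using definable_finite_support[OF Ex.hyps] by blast
  obtain n where n: "\<forall>i<N. r i < n"
    using finite_nat_set_iff_bounded[of "r ` {..<N}"] by auto
  have eq: "P ((\<lambda>i. s (r i))(k := x)) = P (\<lambda>i. (s(n := x)) ((r(k := n)) i))" for s x
    by (rule N) (use n in \<open>auto simp: less_imp_neq\<close>)
  show ?case
    unfolding eq by (rule definable.Ex[OF Ex.IH])
qed

definition merge :: "(nat \<Rightarrow> 'a) \<Rightarrow> (nat \<Rightarrow> 'a) \<Rightarrow> nat \<Rightarrow> 'a" where
  "merge s p i = (if even i then s (i div 2) else p (i div 2))"

text \<open>The parameters occupy the odd variables. Since bound variables are de Bruijn style in the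
  closure rules below, \<open>s 0\<close> is always the innermost one.\<close>

definition pdef :: "((nat \<Rightarrow> 'a::set_universe) \<Rightarrow> bool) \<Rightarrow> bool" where
  "pdef P \<longleftrightarrow> (\<exists>Q p. definable Q \<and> (\<forall>s. P s \<longleftrightarrow> Q (merge s p)))"

lemma pdefI: "definable Q \<Longrightarrow> (\<And>s. P s \<longleftrightarrow> Q (\<lambda>i. merge s p (r i))) \<Longrightarrow> pdef P"
  unfolding pdef_def using definable_rename by fast

lemma pdef_Not: "pdef P \<Longrightarrow> pdef (\<lambda>s. \<not> P s)"
  unfolding pdef_def using definable.Not by fast

lemma pdef_And:
  assumes "pdef P" "pdef Q"
  shows "pdef (\<lambda>s. P s \<and> Q s)"
proof -
  obtain P' p where P: "definable P'" "\<And>s. P s \<longleftrightarrow> P' (merge s p)"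
    using assms(1) unfolding pdef_def by blast
  obtain Q' q where Q: "definable Q'" "\<And>s. Q s \<longleftrightarrow> Q' (merge s q)"
    using assms(2) unfolding pdef_def by blast
  let ?r1 = "\<lambda>i. if even i then i else 4 * (i div 2) + 1"
  let ?r2 = "\<lambda>i. if even i then i else 4 * (i div 2) + 3"
  have [simp]: "(4 * b + 3) div 2 = Suc (2 * b)" for b :: nat
    by presburger
  have 1: "merge s p = (\<lambda>i. merge s (merge p q) (?r1 i))" for s
    by (auto simp: merge_def fun_eq_iff elim!: oddE)
  have 2: "merge s q = (\<lambda>i. merge s (merge p q) (?r2 i))" for s
    by (auto simp: merge_def fun_eq_iff elim!: oddE)
  have "definable (\<lambda>s. P' (\<lambda>i. s (?r1 i)) \<and> Q' (\<lambda>i. s (?r2 i)))"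
    by (rule definable.And[OF definable_rename[OF P(1)] definable_rename[OF Q(1)]])
  then show ?thesis
  proof (rule pdefI[where r = id and p = "merge p q", unfolded id_apply])
    show "P s \<and> Q s \<longleftrightarrow>
        P' (\<lambda>i. merge s (merge p q) (?r1 i)) \<and> Q' (\<lambda>i. merge s (merge p q) (?r2 i))" for s
      unfolding P(2) Q(2) by (rule arg_cong2[where f = conj, OF arg_cong[OF 1] arg_cong[OF 2]])
  qed
qed

text \<open>The quantified variable takes the place of a fresh parameter.\<close>

lemma pdef_Ex:
  assumes "pdef (\<lambda>s. P (s 0) (\<lambda>i. s (Suc i)))"
  shows "pdef (\<lambda>s. \<exists>x. P x s)"
proof -
  obtain Q p where Q: "definable Q" "\<And>s. P (s 0) (\<lambda>i. s (Suc i)) \<longleftrightarrow> Q (merge s p)"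
    using assms unfolding pdef_def by blast
  let ?r = "\<lambda>i. if i = 0 then 1 else if even i then i - 2 else i + 2"
  let ?p = "\<lambda>i. if i = 0 then undefined else p (i - 1)"
  have eq: "merge (case_nat x s) p = (\<lambda>i. ((merge s ?p)(1 := x)) (?r i))" for x s
  proof
    fix i
    show "merge (case_nat x s) p i = ((merge s ?p)(1 := x)) (?r i)"
    proof (cases "even i")
      case True
      then obtain k where "i = 2 * k" by blast
      then show ?thesis by (cases k) (auto simp: merge_def)
    next
      case False
      then obtain k where "i = 2 * k + 1" by (metis oddE)
      then show ?thesis by (auto simp: merge_def)
    qed
  qed
  have P: "P x s \<longleftrightarrow> Q (\<lambda>i. ((merge s ?p)(1 := x)) (?r i))" for x s
    using Q(2)[of "case_nat x s"] unfolding eq by simp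
  show ?thesis
    unfolding pdef_def P
    by (intro exI[of _ "\<lambda>s. \<exists>x. Q (\<lambda>i. (s(1 := x)) (?r i))"] exI[of _ ?p] conjI
        definable.Ex[OF definable_rename[OF Q(1)]]) simp
qed

lemma pdef_iffI: "pdef Q \<Longrightarrow> (\<And>s. P s \<longleftrightarrow> Q s) \<Longrightarrow> pdef P"
  unfolding pdef_def by simp

lemma pdef_Or: "pdef P \<Longrightarrow> pdef Q \<Longrightarrow> pdef (\<lambda>s. P s \<or> Q s)"
  by (rule pdef_iffI[OF pdef_Not[OF pdef_And[OF pdef_Not pdef_Not]]]) auto

lemma pdef_Imp: "pdef P \<Longrightarrow> pdef Q \<Longrightarrow> pdef (\<lambda>s. P s \<longrightarrow> Q s)"
  by (rule pdef_iffI[OF pdef_Not[OF pdef_And[OF _ pdef_Not]]]) auto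

lemma pdef_Iff: "pdef P \<Longrightarrow> pdef Q \<Longrightarrow> pdef (\<lambda>s. P s \<longleftrightarrow> Q s)"
  by (rule pdef_iffI[OF pdef_And[OF pdef_Imp[of P Q] pdef_Imp[of Q P]]]) auto

lemma pdef_All: "pdef (\<lambda>s. P (s 0) (\<lambda>i. s (Suc i))) \<Longrightarrow> pdef (\<lambda>s. \<forall>x. P x s)"
  by (rule pdef_iffI[OF pdef_Not[OF pdef_Ex[OF pdef_Not]]]) auto

definition tdef :: "((nat \<Rightarrow> 'a::set_universe) \<Rightarrow> 'a) \<Rightarrow> bool" where
  "tdef t \<longleftrightarrow> pdef (\<lambda>s. s 0 = t (\<lambda>i. s (Suc i)))"

lemma tdef_var: "tdef (\<lambda>s. s i)"
  unfolding tdef_def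
  by (rule pdefI[OF definable.Eq[of 0 1], where r = "\<lambda>k. if k = 0 then 0 else 2 * Suc i"])
    (simp add: merge_def)

lemma tdef_const: "tdef (\<lambda>s. c)"
  unfolding tdef_def
  by (rule pdefI[OF definable.Eq[of 0 1], where r = id and p = "\<lambda>_. c"])
    (simp add: merge_def)

lemma pdef_subst:
  assumes "pdef (\<lambda>s. P (s 0) (\<lambda>i. s (Suc i)))" "tdef t"
  shows "pdef (\<lambda>s. P (t s) s)"
  by (rule pdef_iffI[OF pdef_Ex[OF pdef_And[OF assms(2)[unfolded tdef_def] assms(1)]]]) auto

lemma pdef_rename:
  assumes "pdef P"
  shows "pdef (\<lambda>s. P (\<lambda>i. s (r i)))"
proof -
  obtain Q p where Q: "definable Q" "\<And>s. P s \<longleftrightarrow> Q (merge s p)"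
    using assms unfolding pdef_def by blast
  show ?thesis
    unfolding Q(2)
    by (rule pdefI[OF Q(1), where p = p and r = "\<lambda>i. if even i then 2 * r (i div 2) else i"])
      (auto simp: merge_def intro!: arg_cong[where f = Q])
qed

lemma tdef_rename: "tdef t \<Longrightarrow> tdef (\<lambda>s. t (\<lambda>i. s (r i)))"
  unfolding tdef_def by (drule pdef_rename[where r = "case_nat 0 (\<lambda>i. Suc (r i))"]) simp

lemma pdef_comp2:
  assumes "pdef (\<lambda>s. P (s 0) (s 1))" "tdef t" "tdef u"
  shows "pdef (\<lambda>s. P (t s) (u s))"
proof (rule pdef_subst[where P = "\<lambda>x s. P x (u s)" and t = t])
  have *: "pdef (\<lambda>s. P (s (Suc 0)) (s 0))"
    using pdef_rename[OF assms(1), where r = "\<lambda>i. 1 - i"] by simp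
  show "pdef (\<lambda>s. P (s 0) (u (\<lambda>i. s (Suc i))))"
  proof (rule pdef_subst[where P = "\<lambda>x s. P (s 0) x" and t = "\<lambda>s. u (\<lambda>i. s (Suc i))"])
    show "pdef (\<lambda>s. P (s (Suc 0)) (s 0))" by (rule *)
    show "tdef (\<lambda>s. u (\<lambda>i. s (Suc i)))" by (rule tdef_rename[OF assms(3)])
  qed
qed (rule assms)

lemma pdef_mem: "tdef t \<Longrightarrow> tdef u \<Longrightarrow> pdef (\<lambda>s. t s \<in> elts (u s))"
  by (rule pdef_comp2[where P = "\<lambda>x y. x \<in> elts y"])
    (rule pdefI[OF definable.Mem[of 0 1], where r = "\<lambda>i. 2 * i"], simp_all add: merge_def)

lemma pdef_eq: "tdef t \<Longrightarrow> tdef u \<Longrightarrow> pdef (\<lambda>s. t s = u s)"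
  by (rule pdef_comp2[where P = "\<lambda>x y. x = y"])
    (rule pdefI[OF definable.Eq[of 0 1], where r = "\<lambda>i. 2 * i"], simp_all add: merge_def)

lemma pdef_is_class_rel:
  assumes "is_class_rel R" "tdef t" "tdef u"
  shows "pdef (\<lambda>s. R (t s) (u s))"
proof (rule pdef_comp2[OF _ assms(2,3)])
  obtain P s0 where P: "definable P" "\<And>x y. R x y \<longleftrightarrow> P (s0(0 := x, 1 := y))"
    using assms(1) unfolding is_class_rel_def by blast
  show "pdef (\<lambda>s. R (s 0) (s 1))"
    unfolding P(2)
    by (rule pdefI[OF P(1), where p = s0 and r = "\<lambda>i. if i \<le> 1 then 2 * i else 2 * i + 1"])
      (auto simp: merge_def intro!: arg_cong[where f = P])
qed

lemma is_class_pdef: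
  assumes "pdef (\<lambda>s. P (s 0))"
  shows "is_class {x. P x}"
proof -
  obtain Q p where Q: "definable Q" "\<And>s. P (s 0) \<longleftrightarrow> Q (merge s p)"
    using assms unfolding pdef_def by blast
  have eq: "merge ((merge p p)(0 := x)) p = (merge (merge p p) p)(0 := x)" for x
    by (auto simp: merge_def fun_eq_iff)
  have "P x \<longleftrightarrow> Q ((merge (merge p p) p)(0 := x))" for x
    using Q(2)[of "(merge p p)(0 := x)"] unfolding eq by simp
  then show ?thesis
    unfolding is_class_def using Q(1) by blast
qed

lemma is_class_rel_pdef:
  assumes "pdef (\<lambda>s. R (s 0) (s 1))"
  shows "is_class_rel R"
proof -
  obtain Q p where Q: "definable Q" "\<And>s. R (s 0) (s 1) \<longleftrightarrow> Q (merge s p)"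
    using assms unfolding pdef_def by blast
  let ?r = "\<lambda>i::nat. if i = 1 then 2 else if i = 2 then 1 else i"
  have eq: "merge (p(0 := x, 1 := y)) p = (\<lambda>i. ((\<lambda>i. merge p p (?r i))(0 := x, 1 := y)) (?r i))" for x y
    by (auto simp: merge_def fun_eq_iff elim!: evenE)
  have "R x y \<longleftrightarrow> Q (\<lambda>i. ((\<lambda>i. merge p p (?r i))(0 := x, 1 := y)) (?r i))" for x y
    using Q(2)[of "p(0 := x, 1 := y)"] unfolding eq by simp
  then show ?thesis
    unfolding is_class_rel_def using definable_rename[OF Q(1), of ?r] by blast
qed

section \<open>Sets and functions\<close>

lemma elts_inject: "elts x = elts y \<longleftrightarrow> x = (y::'a::zfc)"
  using extensionality by blast

lemma elts_set_of: "elts z = A \<Longrightarrow> elts (set_of A) = (A :: 'a::zfc set)"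
  unfolding set_of_def by (rule theI[where P = "\<lambda>x. elts x = A"]) (auto simp: elts_inject[symmetric])

lemma elts_pair [simp]: "elts (set_of {x, y :: 'a::zfc}) = {x, y}"
  using pairing[of x y] elts_set_of by blast

lemma elts_singleton [simp]: "elts (set_of {x :: 'a::zfc}) = {x}"
  using elts_pair[of x x] by simp

lemma elts_opair: "elts (opair x y) = {set_of {x}, set_of {x, y :: 'a::zfc}}"
  by (simp add: opair_def)

lemma set_of_pair_iff: "z = set_of {x, y :: 'a::zfc} \<longleftrightarrow> elts z = {x, y}"
  using elts_inject[of z "set_of {x, y}"] by auto

lemma opair_inject [simp]: "opair x y = opair x' y' \<longleftrightarrow> x = x' \<and> y = (y' :: 'a::zfc)"
proof -
  have [simp]: "set_of {a} = set_of {b} \<longleftrightarrow> a = b"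
    "set_of {a} = set_of {b, c} \<longleftrightarrow> a = b \<and> a = c"
    "set_of {b, c} = set_of {a} \<longleftrightarrow> a = b \<and> a = c"
    "set_of {a, b} = set_of {c, d} \<longleftrightarrow> a = c \<and> b = d \<or> a = d \<and> b = c" for a b c d :: 'a
    by (auto simp: elts_inject[symmetric] doubleton_eq_iff)
  show ?thesis
    unfolding elts_inject[symmetric, of "opair x y"] elts_opair doubleton_eq_iff by auto
qed

lemma app_equality:
  assumes "fun_on f X" "x \<in> elts X"
  shows "opair x y \<in> elts f \<longleftrightarrow> app f x = y"
proof -
  have "\<exists>!y. opair x y \<in> elts f" using assms unfolding fun_on_def by blast
  then show ?thesis unfolding app_def by (auto intro: the_equality theI')
qed

lemma fun_onI:
  assumes "elts f = {opair x (F x) | x. x \<in> elts X}"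
  shows "fun_on f X" "x \<in> elts X \<Longrightarrow> app f x = F x"
proof -
  show *: "fun_on f X" using assms by (auto simp: fun_on_def)
  show "x \<in> elts X \<Longrightarrow> app f x = F x" using app_equality[OF *] assms by blast
qed

section \<open>Bounded formulas\<close>

inductive delta0 :: "((nat \<Rightarrow> 'a::set_universe) \<Rightarrow> bool) \<Rightarrow> bool" where
  Mem: "delta0 (\<lambda>s. s i \<in> elts (s j))"
| Eq: "delta0 (\<lambda>s. s i = s j)"
| Not: "delta0 P \<Longrightarrow> delta0 (\<lambda>s. \<not> P s)"
| And: "delta0 P \<Longrightarrow> delta0 Q \<Longrightarrow> delta0 (\<lambda>s. P s \<and> Q s)"
| BEx: "delta0 P \<Longrightarrow> delta0 (\<lambda>s. \<exists>x\<in>elts (s j). P (case_nat x s))"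

lemma delta0_iffI: "delta0 Q \<Longrightarrow> (\<And>s. P s \<longleftrightarrow> Q s) \<Longrightarrow> delta0 P"
  by presburger

lemma delta0_Or: "delta0 P \<Longrightarrow> delta0 Q \<Longrightarrow> delta0 (\<lambda>s. P s \<or> Q s)"
  by (rule delta0_iffI[OF delta0.Not[OF delta0.And[OF delta0.Not delta0.Not]]]) auto

lemma delta0_Imp: "delta0 P \<Longrightarrow> delta0 Q \<Longrightarrow> delta0 (\<lambda>s. P s \<longrightarrow> Q s)"
  by (rule delta0_iffI[OF delta0.Not[OF delta0.And[OF _ delta0.Not]]]) auto

lemma delta0_Bex:
  "delta0 (\<lambda>s. P (s 0) (\<lambda>i. s (Suc i))) \<Longrightarrow> delta0 (\<lambda>s. \<exists>x\<in>elts (s j). P x s)"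
  by (rule delta0_iffI[OF delta0.BEx]) auto

lemma delta0_Ball:
  "delta0 (\<lambda>s. P (s 0) (\<lambda>i. s (Suc i))) \<Longrightarrow> delta0 (\<lambda>s. \<forall>x\<in>elts (s j). P x s)"
  by (rule delta0_iffI[OF delta0.Not[OF delta0_Bex[OF delta0.Not]]]) auto

lemmas delta0_intros = delta0.Mem delta0.Eq delta0.Not delta0.And delta0_Or delta0_Imp
  delta0_Bex delta0_Ball

lemma delta0_rename: "delta0 P \<Longrightarrow> delta0 (\<lambda>s. P (\<lambda>i. s (r i)))"
proof (induction arbitrary: r rule: delta0.induct)
  case (BEx P j)
  have "P (case_nat x (\<lambda>i. s (r i))) \<longleftrightarrow> P (\<lambda>i. case_nat x s (case_nat 0 (\<lambda>i. Suc (r i)) i))" for x s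
    by (rule arg_cong[where f = P]) (auto split: nat.split)
  then show ?case by (simp add: delta0.BEx[OF BEx.IH])
qed (auto intro: delta0.intros)

lemma delta0_subset: "delta0 (\<lambda>s. elts (s i) \<subseteq> elts (s j))"
  unfolding subset_eq by (intro delta0_intros)

lemma delta0_pair: "delta0 (\<lambda>s::nat \<Rightarrow> 'a::zfc. s i = set_of {s j, s k})"
proof (rule delta0_iffI)
  show "delta0 (\<lambda>s::nat \<Rightarrow> 'a. s j \<in> elts (s i) \<and> s k \<in> elts (s i) \<and> (\<forall>x\<in>elts (s i). x = s j \<or> x = s k))"
    by (intro delta0_intros)
qed (auto simp: set_of_pair_iff)

lemma delta0_opair: "delta0 (\<lambda>s::nat \<Rightarrow> 'a::zfc. s i = opair (s j) (s k))"
proof (rule delta0_iffI)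
  show "delta0 (\<lambda>s::nat \<Rightarrow> 'a. \<exists>a\<in>elts (s i). \<exists>b\<in>elts (s i).
      a = set_of {s j, s j} \<and> b = set_of {s j, s k} \<and> s i = set_of {a, b})"
    by (intro delta0_intros delta0_pair)
qed (auto simp: opair_def)

lemma delta0_pdef:
  assumes "delta0 P" "\<And>i. tdef (t i)"
  shows "pdef (\<lambda>s. P (\<lambda>i. t i s))"
  using assms
proof (induction arbitrary: t)
  case (BEx P j)
  let ?t = "case_nat (\<lambda>s. s 0) (\<lambda>i s. t i (\<lambda>i. s (Suc i)))"
  have "tdef (?t i)" for i
    by (cases i) (use BEx.prems tdef_var tdef_rename in auto)
  from BEx.IH[OF this]
  have "pdef (\<lambda>s. P (case_nat (s 0) (\<lambda>i. t i (\<lambda>i. s (Suc i)))))"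
    by (rule pdef_iffI) (auto intro!: arg_cong[where f = P] split: nat.split)
  then show ?case
    unfolding Bex_def by (intro pdef_Ex pdef_And pdef_mem tdef_rename[OF BEx.prems] tdef_var)
qed (auto intro: pdef_Not pdef_And pdef_mem pdef_eq)

lemma tdef_opair:
  assumes "tdef t" "tdef u"
  shows "tdef (\<lambda>s. opair (t s) (u s) :: 'a::zfc)"
proof -
  let ?t = "\<lambda>i s. if i = 0 then s 0 else if i = 1 then t (\<lambda>i. s (Suc i)) else u (\<lambda>i. s (Suc i))"
  have "tdef (?t i)" for i
    by (cases "i = 0"; cases "i = 1") (use assms tdef_var tdef_rename in auto)
  from delta0_pdef[OF delta0_opair[of 0 1 2], of ?t, OF this] show ?thesis
    by (simp add: tdef_def)
qed

lemma tdef_comp1: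
  assumes "tdef (\<lambda>s. F (s 0))" "tdef t"
  shows "tdef (\<lambda>s. F (t s))"
  unfolding tdef_def
  by (rule pdef_comp2[where P = "\<lambda>x y. x = F y"])
    (use assms tdef_var tdef_rename in \<open>auto simp: tdef_def[of "\<lambda>s. F (s 0)"]\<close>)

lemmas pdef_intros = pdef_Not pdef_And pdef_Or pdef_Imp pdef_Iff pdef_Ex pdef_All
  pdef_mem pdef_eq tdef_var tdef_const tdef_opair

section \<open>Separation, replacement and choice\<close>

lemma separation_pdef:
  assumes "pdef (\<lambda>s. P (s 0))"
  shows "\<exists>z. elts z = {x \<in> elts X. P (x :: 'a::zfc)}"
  using separation[OF is_class_pdef[OF assms], of X] by (simp add: Int_def)

lemma replacement_pdef:
  assumes "pdef (\<lambda>s. R (s 0) (s 1))" "\<And>x. x \<in> elts X \<Longrightarrow> \<exists>!y. R x (y :: 'a::zfc)"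
  shows "\<exists>z. elts z = {y. \<exists>x\<in>elts X. R x y}"
  by (rule replacement[OF is_class_rel_pdef[OF assms(1)]]) (intro ballI assms(2))

lemma fun_on_exists:
  assumes R: "pdef (\<lambda>s. R (s 0) (s 1))" and ex: "\<And>x. x \<in> elts X \<Longrightarrow> \<exists>!y. R x (y :: 'a::zfc)"
  shows "\<exists>f. fun_on f X \<and> (\<forall>x\<in>elts X. R x (app f x))"
proof -
  define F where "F x = (THE y. R x y)" for x
  have F: "R x y \<longleftrightarrow> y = F x" if "x \<in> elts X" for x y
    unfolding F_def using ex[OF that] by (metis the_equality)
  have "\<exists>z. elts z = {p. \<exists>x\<in>elts X. \<exists>y. R x y \<and> p = opair x y}"
    by (rule replacement_pdef) (intro pdef_intros pdef_comp2[OF R], use ex in blast)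
  moreover have "{p. \<exists>x\<in>elts X. \<exists>y. R x y \<and> p = opair x y} = {opair x (F x) | x. x \<in> elts X}"
    using F by auto
  ultimately obtain f where "elts f = {opair x (F x) | x. x \<in> elts X}" by auto
  from fun_onI[OF this] show ?thesis using F by (intro exI[of _ f]) simp
qed

lemma fun_on_exists_tdef:
  assumes "tdef (\<lambda>s. F (s 0))"
  shows "\<exists>f. fun_on f X \<and> (\<forall>x\<in>elts X. app f x = (F x :: 'a::zfc))"
  by (rule fun_on_exists[where R = "\<lambda>x y. y = F x"]) (intro pdef_intros tdef_comp1[OF assms], blast)

lemma choice_fun:
  assumes R: "pdef (\<lambda>s. R (s 0) (s 1))" and F: "tdef (\<lambda>s. F (s 0))"
    and ex: "\<And>x. x \<in> elts X \<Longrightarrow> \<exists>y\<in>elts (F x). R x (y :: 'a::zfc)"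
  shows "\<exists>f. fun_on f X \<and> (\<forall>x\<in>elts X. app f x \<in> elts (F x) \<and> R x (app f x))"
proof -
  define S where "S x v \<longleftrightarrow> (\<forall>p. p \<in> elts v \<longleftrightarrow> (\<exists>y. y \<in> elts (F x) \<and> R x y \<and> p = opair x y))" for x v
  have S: "pdef (\<lambda>s. S (s 0) (s 1))"
    unfolding S_def by (intro pdef_intros tdef_comp1[OF F] pdef_comp2[OF R])
  have "\<exists>!v. S x v" for x
  proof -
    obtain z where z: "elts z = {y \<in> elts (F x). R x y}"
      using separation_pdef[of "R x" "F x"] pdef_comp2[OF R tdef_const tdef_var] by blast
    have "\<exists>v. elts v = {p. \<exists>y\<in>elts z. p = opair x y}"
      by (rule replacement_pdef) (intro pdef_intros, blast)
    then obtain v where v: "elts v = {p. \<exists>y\<in>elts z. p = opair x y}" ..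
    have "S x v" unfolding S_def v z by blast
    moreover have "v' = v" if "S x v'" for v'
      using \<open>S x v\<close> that unfolding S_def by (intro extensionality) blast
    ultimately show ?thesis by blast
  qed
  then obtain Z where Z: "elts Z = {v. \<exists>x\<in>elts X. S x v}"
    using replacement_pdef[OF S] by blast
  have "\<exists>c. \<forall>u\<in>elts Z. \<exists>!w. w \<in> elts c \<inter> elts u"
  proof (rule choice)
    show "\<forall>u\<in>elts Z. elts u \<noteq> {}"
      unfolding Z S_def using ex by blast
    show "\<forall>u\<in>elts Z. \<forall>v\<in>elts Z. u \<noteq> v \<longrightarrow> elts u \<inter> elts v = {}"
    proof (intro ballI impI)
      fix u v assume uv: "u \<in> elts Z" "v \<in> elts Z" "u \<noteq> v"
      then obtain x y where "S x u" "S y v" unfolding Z by blast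
      moreover from this have "x \<noteq> y" using \<open>\<And>x. \<exists>!v. S x v\<close> uv(3) by blast
      ultimately show "elts u \<inter> elts v = {}" unfolding S_def by auto
    qed
  qed
  then obtain c where c: "\<And>u. u \<in> elts Z \<Longrightarrow> \<exists>!w. w \<in> elts c \<inter> elts u" by blast
  let ?R = "\<lambda>x y. y \<in> elts (F x) \<and> R x y \<and> opair x y \<in> elts c"
  have "\<exists>f. fun_on f X \<and> (\<forall>x\<in>elts X. ?R x (app f x))"
  proof (rule fun_on_exists)
    show "pdef (\<lambda>s. ?R (s 0) (s 1))"
      by (intro pdef_intros tdef_comp1[OF F] pdef_comp2[OF R])
    fix x assume x: "x \<in> elts X"
    obtain v where v: "S x v" using \<open>\<And>x. \<exists>!v. S x v\<close> by blast
    have "\<exists>!w. w \<in> elts c \<inter> elts v" by (rule c) (use x v Z in blast)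
    then obtain w where w: "w \<in> elts c" "w \<in> elts v"
      and eq: "\<And>w'. w' \<in> elts c \<Longrightarrow> w' \<in> elts v \<Longrightarrow> w' = w" by blast
    have v': "p \<in> elts v \<longleftrightarrow> (\<exists>y. y \<in> elts (F x) \<and> R x y \<and> p = opair x y)" for p
      using v unfolding S_def by (rule spec)
    obtain y where y: "y \<in> elts (F x)" "R x y" "w = opair x y"
      using w(2) v'[of w] by (elim iffE) blast
    have "y' = y" if "?R x y'" for y'
      using eq[of "opair x y'"] that v'[of "opair x y'"] y(3) by auto
    moreover have "?R x y" using y w(1) by simp
    ultimately show "\<exists>!y. ?R x y" by (rule ex1I[rotated])
  qed
  then show ?thesis by blast
qed

lemma tdef_app:
  assumes "fun_on f X" "tdef t"
  shows "tdef (\<lambda>s. if t s \<in> elts X then app f (t s) else X :: 'a::zfc)"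
  unfolding tdef_def
proof (rule pdef_iffI)
  let ?t = "\<lambda>s. t (\<lambda>i. s (Suc i))"
  show "pdef (\<lambda>s. ?t s \<in> elts X \<and> opair (?t s) (s 0) \<in> elts f \<or> ?t s \<notin> elts X \<and> s 0 = X)"
    by (intro pdef_intros tdef_rename[OF assms(2)])
  show "s 0 = (if ?t s \<in> elts X then app f (?t s) else X) \<longleftrightarrow>
      ?t s \<in> elts X \<and> opair (?t s) (s 0) \<in> elts f \<or> ?t s \<notin> elts X \<and> s 0 = X" for s
    using app_equality[OF assms(1), of "?t s" "s 0"] by (cases "?t s \<in> elts X") auto
qed

lemma const_fun_elts: "elts (const_fun X a) = {opair x a | x. x \<in> elts (X :: 'a::zfc)}"
proof -
  have "\<exists>v. elts v = {p. \<exists>x\<in>elts X. p = opair x a}"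
    by (rule replacement_pdef) (intro pdef_intros, blast)
  then obtain v where "elts v = (\<lambda>x. opair x a) ` elts X" by (auto simp: image_def)
  from elts_set_of[OF this] show ?thesis unfolding const_fun_def by auto
qed

lemmas fun_on_const = fun_onI(1)[OF const_fun_elts]
  and app_const = fun_onI(2)[OF const_fun_elts]

lemma tdef_const_fun:
  assumes "tdef t"
  shows "tdef (\<lambda>s. const_fun X (t s) :: 'a::zfc)"
  unfolding tdef_def
proof (rule pdef_iffI)
  let ?t = "\<lambda>s. t (\<lambda>i. s (Suc i))"
  show "pdef (\<lambda>s. \<forall>p. p \<in> elts (s 0) \<longleftrightarrow> (\<exists>x. x \<in> elts X \<and> p = opair x (?t s)))"
    by (intro pdef_intros tdef_rename[OF assms])
  fix s :: "nat \<Rightarrow> 'a"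
  show "s 0 = const_fun X (?t s) \<longleftrightarrow> (\<forall>p. p \<in> elts (s 0) \<longleftrightarrow> (\<exists>x. x \<in> elts X \<and> p = opair x (?t s)))"
    unfolding elts_inject[symmetric, of "s 0"] const_fun_elts set_eq_iff by (simp add: conj_commute)
qed

section \<open>Ultrafilters\<close>

definition subset_in :: "'a::zfc set \<Rightarrow> 'a \<Rightarrow> ('a \<Rightarrow> bool) \<Rightarrow> bool" where
  "subset_in M X P \<longleftrightarrow> (\<exists>A\<in>M. elts A = {x \<in> elts X. P x})"

lemma subset_in_UNIV: "pdef (\<lambda>s. P (s 0)) \<Longrightarrow> subset_in UNIV X P"
  unfolding subset_in_def using separation_pdef[of P X] by simp

lemma almost_all_cong:
  "(\<And>x. x \<in> elts X \<Longrightarrow> P x \<longleftrightarrow> Q x) \<Longrightarrow> almost_all X U P \<longleftrightarrow> almost_all X U Q"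
proof -
  assume "\<And>x. x \<in> elts X \<Longrightarrow> P x \<longleftrightarrow> Q x"
  then have "{x \<in> elts X. P x} = {x \<in> elts X. Q x}" by auto
  then show ?thesis unfolding almost_all_def by simp
qed

context
  fixes M :: "'a::zfc set" and X U
  assumes U: "ultrafilter_in M X U"
begin

lemma ultrafilter_nonempty: "A \<in> elts U \<Longrightarrow> elts A \<noteq> {}"
  using bspec[OF U[unfolded ultrafilter_in_def, THEN conjunct2, THEN conjunct2, THEN conjunct1]] by (rule conjunct2)

lemma ultrafilter_space: "X \<in> elts U"
  by (rule U[unfolded ultrafilter_in_def, THEN conjunct2, THEN conjunct2, THEN conjunct2, THEN conjunct1])

lemma ultrafilter_up: "\<lbrakk>A \<in> elts U; B \<in> M; elts A \<subseteq> elts B; elts B \<subseteq> elts X\<rbrakk> \<Longrightarrow> B \<in> elts U"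
  using bspec[OF bspec[OF U[unfolded ultrafilter_in_def, THEN conjunct2, THEN conjunct2, THEN conjunct2, THEN conjunct2, THEN conjunct1]]] by blast

lemma ultrafilter_Int: "\<lbrakk>A \<in> elts U; B \<in> elts U\<rbrakk> \<Longrightarrow> \<exists>C\<in>elts U. elts C = elts A \<inter> elts B"
  by (rule bspec[OF bspec[OF U[unfolded ultrafilter_in_def, THEN conjunct2, THEN conjunct2, THEN conjunct2, THEN conjunct2, THEN conjunct2, THEN conjunct1]]])

lemma ultrafilter_compl:
  "\<lbrakk>A \<in> M; elts A \<subseteq> elts X\<rbrakk> \<Longrightarrow> A \<in> elts U \<or> (\<exists>B\<in>elts U. elts B = elts X - elts A)"
  by (rule mp[OF bspec[OF U[unfolded ultrafilter_in_def, THEN conjunct2, THEN conjunct2, THEN conjunct2, THEN conjunct2, THEN conjunct2, THEN conjunct2]]])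

lemma almost_all_True: "(\<And>x. x \<in> elts X \<Longrightarrow> P x) \<Longrightarrow> almost_all X U P"
  using ultrafilter_space unfolding almost_all_def by (intro bexI[of _ X]) auto

lemma not_almost_all_False: "(\<And>x. x \<in> elts X \<Longrightarrow> \<not> P x) \<Longrightarrow> \<not> almost_all X U P"
  using ultrafilter_nonempty unfolding almost_all_def by auto

lemma almost_all_const: "almost_all X U (\<lambda>x. p) \<longleftrightarrow> p"
  using almost_all_True[of "\<lambda>_. p"] not_almost_all_False[of "\<lambda>_. p"] by (cases p) simp_all

lemma almost_all_conj:
  assumes "almost_all X U P" "almost_all X U Q"
  shows "almost_all X U (\<lambda>x. P x \<and> Q x)"
proof -
  obtain A B where A: "A \<in> elts U" "elts A = {x \<in> elts X. P x}"
    and B: "B \<in> elts U" "elts B = {x \<in> elts X. Q x}"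
    using assms unfolding almost_all_def by blast
  obtain C where "C \<in> elts U" "elts C = elts A \<inter> elts B"
    using ultrafilter_Int[OF A(1) B(1)] ..
  then show ?thesis unfolding almost_all_def A B by (intro bexI[of _ C]) auto
qed

lemma almost_all_mono:
  assumes "almost_all X U P" "subset_in M X Q" "\<And>x. x \<in> elts X \<Longrightarrow> P x \<Longrightarrow> Q x"
  shows "almost_all X U Q"
proof -
  obtain A where A: "A \<in> elts U" "elts A = {x \<in> elts X. P x}"
    using assms unfolding almost_all_def by blast
  obtain B where B: "B \<in> M" "elts B = {x \<in> elts X. Q x}"
    using assms unfolding subset_in_def by blast
  have "B \<in> elts U" by (rule ultrafilter_up[OF A(1) B(1)]) (use A B assms(3) in auto)
  then show ?thesis unfolding almost_all_def using B(2) by (rule bexI[rotated])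
qed

lemma almost_all_Not:
  assumes "subset_in M X P"
  shows "almost_all X U (\<lambda>x. \<not> P x) \<longleftrightarrow> \<not> almost_all X U P"
proof
  assume "almost_all X U (\<lambda>x. \<not> P x)"
  then show "\<not> almost_all X U P"
    using almost_all_conj[of "\<lambda>x. \<not> P x" P] not_almost_all_False[of "\<lambda>x. \<not> P x \<and> P x"] by auto
next
  assume not: "\<not> almost_all X U P"
  obtain A where A: "A \<in> M" "elts A = {x \<in> elts X. P x}"
    using assms unfolding subset_in_def by blast
  then have "A \<notin> elts U" using not unfolding almost_all_def by blast
  then obtain B where B: "B \<in> elts U" "elts B = elts X - elts A"
    using ultrafilter_compl[OF A(1)] A(2) by auto
  show "almost_all X U (\<lambda>x. \<not> P x)"
    unfolding almost_all_def using A B by (intro bexI[of _ B]) auto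
qed

end

section \<open>Ultrapowers of the universe\<close>

locale ultrapower =
  fixes X U :: "'a::zfc" and M :: "'a set" and \<pi> :: "'a \<Rightarrow> 'a"
  assumes ultrafilter: "ultrafilter_in UNIV X U"
    and Ult: "is_Ult UNIV X U M \<pi>"
begin

lemma pi_image: "\<pi> ` {f. fun_on f X} = M"
  and pi_trans: "x \<in> M \<Longrightarrow> y \<in> elts x \<Longrightarrow> y \<in> M"
  using Ult unfolding is_Ult_def funs_in_def by simp_all blast

lemma pi_in: "fun_on f X \<Longrightarrow> \<pi> f \<in> M"
  using pi_image by blast

lemma pi_surj: "y \<in> M \<Longrightarrow> \<exists>f. fun_on f X \<and> y = \<pi> f"
  using pi_image by blast

lemma pi_eq: "fun_on f X \<Longrightarrow> fun_on g X \<Longrightarrow> \<pi> f = \<pi> g \<longleftrightarrow> almost_all X U (\<lambda>x. app f x = app g x)"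
  and pi_mem: "fun_on f X \<Longrightarrow> fun_on g X \<Longrightarrow>
    \<pi> f \<in> elts (\<pi> g) \<longleftrightarrow> almost_all X U (\<lambda>x. app f x \<in> elts (app g x))"
  using Ult unfolding is_Ult_def funs_in_def by simp_all

lemma delta0_subset_in:
  assumes "delta0 P" "\<And>i. fun_on (fs i) X"
  shows "subset_in UNIV X (\<lambda>x. P (\<lambda>i. app (fs i) x))"
proof -
  have "pdef (\<lambda>s. P (\<lambda>i. if s 0 \<in> elts X then app (fs i) (s 0) else X))"
    by (rule delta0_pdef[OF assms(1)]) (rule tdef_app[OF assms(2) tdef_var])
  from subset_in_UNIV[where P = "\<lambda>x. P (\<lambda>i. if x \<in> elts X then app (fs i) x else X)", OF this, of X]
  show ?thesis unfolding subset_in_def by (auto cong: conj_cong)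
qed

text \<open>The restriction to bounded formulas avoids relativising them to \<open>M\<close>, where they are absolute,
  and lets the axiom of choice for sets provide the witnesses.\<close>

lemma Los:
  assumes "delta0 P" "\<And>i. fun_on (fs i) X"
  shows "P (\<lambda>i. \<pi> (fs i)) \<longleftrightarrow> almost_all X U (\<lambda>x. P (\<lambda>i. app (fs i) x))"
  using assms
proof (induction arbitrary: fs)
  case (Mem i j)
  then show ?case by (intro pi_mem)
next
  case (Eq i j)
  then show ?case by (intro pi_eq)
next
  case (Not P)
  then show ?case by (simp add: almost_all_Not[OF ultrafilter delta0_subset_in])
next
  case (And P Q)
  note sub = delta0_subset_in[OF _ And.prems]
  show ?case
    unfolding And.IH(1)[OF And.prems] And.IH(2)[OF And.prems]
    by (auto intro: almost_all_conj[OF ultrafilter] almost_all_mono[OF ultrafilter _ sub] And.hyps)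
next
  case (BEx P j)
  let ?Q = "\<lambda>x. \<exists>y\<in>elts (app (fs j) x). P (case_nat y (\<lambda>i. app (fs i) x))"
  have cn: "(\<lambda>i. \<pi> (case_nat g fs i)) = case_nat (\<pi> g) (\<lambda>i. \<pi> (fs i))"
    "(\<lambda>i. app (case_nat g fs i) x) = case_nat (app g x) (\<lambda>i. app (fs i) x)" for g x
    by (auto split: nat.split)
  have sub: "subset_in UNIV X ?Q"
    by (rule delta0_subset_in[OF delta0.BEx[OF BEx.hyps] BEx.prems])
  show ?case
  proof
    assume "\<exists>y\<in>elts (\<pi> (fs j)). P (case_nat y (\<lambda>i. \<pi> (fs i)))"
    then obtain y where y: "y \<in> elts (\<pi> (fs j))" "P (case_nat y (\<lambda>i. \<pi> (fs i)))" by blast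
    obtain g where g: "fun_on g X" "y = \<pi> g"
      using pi_surj[OF pi_trans[OF pi_in[OF BEx.prems] y(1)]] by blast
    have "fun_on (case_nat g fs i) X" for i by (cases i) (use g BEx.prems in auto)
    from BEx.IH[of "case_nat g fs", OF this] y(2) have "almost_all X U (\<lambda>x. P (case_nat (app g x) (\<lambda>i. app (fs i) x)))"
      unfolding cn g(2) by blast
    from almost_all_conj[OF ultrafilter y(1)[unfolded g(2) pi_mem[OF g(1) BEx.prems]] this]
    show "almost_all X U ?Q"
      by (rule almost_all_mono[OF ultrafilter _ sub]) blast
  next
    assume Q: "almost_all X U ?Q"
    then obtain A where A: "A \<in> elts U" "elts A = {x \<in> elts X. ?Q x}"
      unfolding almost_all_def by blast
    let ?app = "\<lambda>i x. if x \<in> elts X then app (fs i) x else X"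
    let ?t = "case_nat (\<lambda>s. s 1) (\<lambda>i s. ?app i (s 0))"
    have "tdef (?t i)" for i
      by (cases i) (simp_all del: One_nat_def add: tdef_var tdef_app[OF BEx.prems tdef_var])
    from delta0_pdef[OF BEx.hyps, of ?t, OF this]
    have R: "pdef (\<lambda>s. P (case_nat (s 1) (\<lambda>i. ?app i (s 0))))"
      by (rule pdef_iffI) (auto intro!: arg_cong[where f = P] split: nat.split)
    have "\<exists>g. fun_on g A \<and> (\<forall>x\<in>elts A. app g x \<in> elts (?app j x) \<and>
        P (case_nat (app g x) (\<lambda>i. ?app i x)))"
      by (rule choice_fun[where F = "?app j" and R = "\<lambda>x y. P (case_nat y (\<lambda>i. ?app i x))"])
        (use R tdef_app[OF BEx.prems tdef_var] A(2) in auto)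
    then obtain g' where g': "fun_on g' A" "\<And>x. x \<in> elts A \<Longrightarrow> app g' x \<in> elts (app (fs j) x) \<and>
        P (case_nat (app g' x) (\<lambda>i. app (fs i) x))"
      using A(2) by auto
    obtain g where g: "fun_on g X" "\<And>x. x \<in> elts X \<Longrightarrow> app g x = (if x \<in> elts A then app g' x else A)"
      using fun_on_exists_tdef[OF tdef_app[OF g'(1) tdef_var], of X] by blast
    have *: "?Q x \<Longrightarrow> app g x \<in> elts (app (fs j) x) \<and> P (case_nat (app g x) (\<lambda>i. app (fs i) x))"
      if "x \<in> elts X" for x
      using that g(2)[OF that] g'(2)[of x] A(2) by simp
    have fs: "fun_on (case_nat g fs i) X" for i by (cases i) (use g BEx.prems in auto)
    have "almost_all X U (\<lambda>x. P (case_nat (app g x) (\<lambda>i. app (fs i) x)))"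
      using delta0_subset_in[of P "case_nat g fs", OF BEx.hyps fs] unfolding cn
      by (rule almost_all_mono[OF ultrafilter Q]) (use * in blast)
    then have "P (case_nat (\<pi> g) (\<lambda>i. \<pi> (fs i)))"
      using BEx.IH[of "case_nat g fs", OF fs] unfolding cn by blast
    moreover have "almost_all X U (\<lambda>x. app g x \<in> elts (app (fs j) x))"
      using delta0_subset_in[of _ "case_nat g fs", OF delta0.Mem[of 0 "Suc j"] fs] unfolding nat.case
      by (rule almost_all_mono[OF ultrafilter Q]) (use * in blast)
    ultimately show "\<exists>y\<in>elts (\<pi> (fs j)). P (case_nat y (\<lambda>i. \<pi> (fs i)))"
      unfolding pi_mem[OF g(1) BEx.prems, symmetric] by blast
  qed
qed

lemma Ult_collect:
  assumes P: "delta0 P" and s: "\<And>i. s i \<in> M"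
    and bdd: "\<And>s. \<exists>v. \<forall>b. P (case_nat b s) \<longrightarrow> b \<in> elts v"
  shows "\<exists>v\<in>M. elts v = {b \<in> M. P (case_nat b s)}"
proof -
  have ex: "\<exists>v. elts v = {b. P (case_nat b s)}" for s
  proof -
    have "tdef (case_nat (\<lambda>s. s 0) (\<lambda>i _. s i) i)" for i
      by (cases i) (simp_all add: tdef_var tdef_const)
    from delta0_pdef[OF P, of "case_nat (\<lambda>s. s 0) (\<lambda>i _. s i)", OF this]
    have "pdef (\<lambda>t. P (case_nat (t 0) s))"
      by (rule pdef_iffI) (auto intro!: arg_cong[where f = P] split: nat.split)
    moreover obtain v where "\<forall>b. P (case_nat b s) \<longrightarrow> b \<in> elts v" using bdd by blast
    ultimately show ?thesis
      using separation_pdef[of "\<lambda>b. P (case_nat b s)" v] by (auto cong: conj_cong)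
  qed
  have "\<forall>i. \<exists>f. fun_on f X \<and> s i = \<pi> f" using pi_surj s by blast
  then obtain fs where fs: "\<And>i. fun_on (fs i) X" "\<And>i. s i = \<pi> (fs i)" by metis
  let ?app = "\<lambda>i x. if x \<in> elts X then app (fs i) x else X"
  let ?t = "case_nat (\<lambda>s. s 0) (\<lambda>i s. ?app i (s 1))"
  have "tdef (?t i)" for i
    by (cases i) (simp_all del: One_nat_def add: tdef_var tdef_app[OF fs(1) tdef_var])
  from delta0_pdef[OF P, of ?t, OF this]
  have R: "pdef (\<lambda>s. P (case_nat (s 0) (\<lambda>i. ?app i (s 1))))"
    by (rule pdef_iffI) (auto intro!: arg_cong[where f = P] split: nat.split)
  have "\<exists>g. fun_on g X \<and> (\<forall>x\<in>elts X. \<forall>b. b \<in> elts (app g x) \<longleftrightarrow> P (case_nat b (\<lambda>i. ?app i x)))"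
  proof (rule fun_on_exists)
    show "pdef (\<lambda>s. \<forall>b. b \<in> elts (s 1) \<longleftrightarrow> P (case_nat b (\<lambda>i. ?app i (s 0))))"
      by (intro pdef_intros pdef_comp2[OF R])
    fix x
    obtain v where v: "elts v = {b. P (case_nat b (\<lambda>i. ?app i x))}" using ex by blast
    show "\<exists>!v. \<forall>b. b \<in> elts v \<longleftrightarrow> P (case_nat b (\<lambda>i. ?app i x))"
    proof
      show "\<forall>b. b \<in> elts v \<longleftrightarrow> P (case_nat b (\<lambda>i. ?app i x))" using v by simp
    next
      fix w assume "\<forall>b. b \<in> elts w \<longleftrightarrow> P (case_nat b (\<lambda>i. ?app i x))"
      then show "w = v" using v by (intro extensionality) auto
    qed
  qed
  then obtain g where g: "fun_on g X"
    "\<And>x b. x \<in> elts X \<Longrightarrow> b \<in> elts (app g x) \<longleftrightarrow> P (case_nat b (\<lambda>i. app (fs i) x))"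
    by auto
  have "b \<in> elts (\<pi> g) \<longleftrightarrow> P (case_nat b s)" if b: "b \<in> M" for b
  proof -
    obtain h where h: "fun_on h X" "b = \<pi> h" using pi_surj[OF b] by blast
    have cn: "(\<lambda>i. \<pi> (case_nat h fs i)) = case_nat (\<pi> h) (\<lambda>i. \<pi> (fs i))"
      "(\<lambda>i. app (case_nat h fs i) x) = case_nat (app h x) (\<lambda>i. app (fs i) x)" for x
      by (auto split: nat.split)
    have hs: "fun_on (case_nat h fs i) X" for i by (cases i) (use h fs in auto)
    have "b \<in> elts (\<pi> g) \<longleftrightarrow> almost_all X U (\<lambda>x. P (case_nat (app h x) (\<lambda>i. app (fs i) x)))"
      unfolding h(2) pi_mem[OF h(1) g(1)] by (rule almost_all_cong) (rule g(2))
    also have "\<dots> \<longleftrightarrow> P (case_nat b s)"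
      using Los[of P "case_nat h fs", OF P hs] unfolding cn h(2) fs(2)[symmetric] by simp
    finally show ?thesis .
  qed
  moreover have "elts (\<pi> g) \<subseteq> M" using pi_trans[OF pi_in[OF g(1)]] by blast
  ultimately have "elts (\<pi> g) = {b \<in> M. P (case_nat b s)}" by blast
  then show ?thesis using pi_in[OF g(1)] by (rule bexI)
qed

lemma Ult_subset_in:
  assumes P: "delta0 P" and s: "\<And>i. s i \<in> M" and Y: "Y \<in> M"
  shows "subset_in M Y (\<lambda>y. P (case_nat y s))"
proof -
  let ?r = "case_nat 0 (\<lambda>i. Suc (Suc i))"
  let ?P = "\<lambda>s. s 0 \<in> elts (s (Suc 0)) \<and> P (\<lambda>i. s (?r i))"
  have eq: "(\<lambda>i. case_nat b (case_nat Y s) (?r i)) = case_nat b s" for b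
    by (auto split: nat.split)
  have "\<exists>v\<in>M. elts v = {b \<in> M. ?P (case_nat b (case_nat Y s))}"
  proof (rule Ult_collect)
    show "delta0 ?P" by (rule delta0.And[OF delta0.Mem delta0_rename[OF P]])
    show "case_nat Y s i \<in> M" for i by (cases i) (simp_all add: s Y)
    show "\<exists>v. \<forall>b. ?P (case_nat b s) \<longrightarrow> b \<in> elts v" for s
      by (rule exI[of _ "s 0"]) simp
  qed
  then show ?thesis
    unfolding eq subset_in_def using pi_trans[OF Y] by (auto cong: conj_cong)
qed

lemma Ult_pair: "a \<in> M \<Longrightarrow> b \<in> M \<Longrightarrow> set_of {a, b} \<in> M"
proof -
  assume ab: "a \<in> M" "b \<in> M"
  let ?P = "\<lambda>s :: nat \<Rightarrow> 'a. s 0 = s 1 \<or> s 0 = s (Suc 1)"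
  have "\<exists>v\<in>M. elts v = {c \<in> M. ?P (case_nat c (case_nat a (\<lambda>_. b)))}"
  proof (rule Ult_collect)
    show "delta0 ?P" by (intro delta0_intros)
    show "case_nat a (\<lambda>_. b) i \<in> M" for i by (cases i) (simp_all add: ab)
    show "\<exists>v. \<forall>b. ?P (case_nat b s) \<longrightarrow> b \<in> elts v" for s
      by (rule exI[of _ "set_of {s 0, s 1}"]) simp
  qed
  then obtain v where v: "v \<in> M" "elts v = {c \<in> M. c = a \<or> c = b}" by auto
  then have "v = set_of {a, b}" using ab by (intro extensionality) auto
  then show ?thesis using v(1) by simp
qed

lemma Ult_opair: "a \<in> M \<Longrightarrow> b \<in> M \<Longrightarrow> opair a b \<in> M"
  unfolding opair_def using Ult_pair Ult_pair[of a a] by simp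

lemma Ult_const_fun: "Y \<in> M \<Longrightarrow> a \<in> M \<Longrightarrow> const_fun Y a \<in> M"
proof -
  assume Ya: "Y \<in> M" "a \<in> M"
  let ?P = "\<lambda>s. \<exists>y\<in>elts (s 1). s 0 = opair y (s (Suc 1))"
  have "\<exists>v\<in>M. elts v = {c \<in> M. ?P (case_nat c (case_nat Y (\<lambda>_. a)))}"
  proof (rule Ult_collect)
    show "delta0 ?P" by (intro delta0_intros delta0_opair)
    show "case_nat Y (\<lambda>_. a) i \<in> M" for i by (cases i) (simp_all add: Ya)
    show "\<exists>v. \<forall>b. ?P (case_nat b s) \<longrightarrow> b \<in> elts v" for s
      by (rule exI[of _ "const_fun (s 0) (s 1)"]) (auto simp: const_fun_elts)
  qed
  then obtain v where v: "v \<in> M" "elts v = {c \<in> M. \<exists>y\<in>elts Y. c = opair y a}" by auto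
  moreover have "opair y a \<in> M" if "y \<in> elts Y" for y
    using Ult_opair[OF pi_trans[OF Ya(1) that] Ya(2)] .
  ultimately have "v = const_fun Y a" by (intro extensionality) (auto simp: const_fun_elts)
  then show ?thesis using v(1) by simp
qed

lemma Ult_subset_in_app:
  assumes P: "delta0 P" and s: "\<And>i. s i \<in> M" and f: "f \<in> M" "Y \<in> M" "fun_on f Y"
  shows "subset_in M Y (\<lambda>y. P (case_nat (app f y) s))"
proof -
  let ?r = "case_nat 0 (\<lambda>i. Suc (Suc (Suc (Suc (Suc i)))))"
  let ?P = "\<lambda>s. \<exists>p\<in>elts (s 1). \<exists>u\<in>elts p. \<exists>c\<in>elts u.
    p = opair (s 0) c \<and> P (case_nat c (\<lambda>i. s (Suc (Suc i))))"
  have eq: "(\<lambda>i. s (?r i)) = case_nat (s 0) (\<lambda>i. s (Suc (Suc (Suc (Suc (Suc i))))))"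
    for s :: "nat \<Rightarrow> 'a" by (auto split: nat.split)
  have "delta0 (\<lambda>s. P (case_nat (s 0) (\<lambda>i. s (Suc (Suc (Suc (Suc (Suc i))))))))"
    using delta0_rename[OF P, of ?r] unfolding eq .
  then have "delta0 ?P"
    by (intro delta0_intros delta0_opair)
  moreover have "case_nat f s i \<in> M" for i by (cases i) (simp_all add: s f)
  ultimately have "subset_in M Y (\<lambda>y. ?P (case_nat y (case_nat f s)))"
    using f(2) by (rule Ult_subset_in)
  moreover have "?P (case_nat y (case_nat f s)) \<longleftrightarrow> P (case_nat (app f y) s)" if y: "y \<in> elts Y" for y
  proof -
    have *: "opair y c \<in> elts f \<longleftrightarrow> c = app f y" for c
      using app_equality[OF f(3) y] by auto
    have "(\<exists>p\<in>elts f. \<exists>u\<in>elts p. \<exists>c\<in>elts u. p = opair y c \<and> Q c) \<longleftrightarrow> Q (app f y)" for Q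
    proof
      assume "Q (app f y)"
      then show "\<exists>p\<in>elts f. \<exists>u\<in>elts p. \<exists>c\<in>elts u. p = opair y c \<and> Q c"
        using * by (intro bexI[of _ "opair y (app f y)"] bexI[of _ "set_of {y, app f y}"]
            bexI[of _ "app f y"]) (simp_all add: elts_opair)
    next
      assume "\<exists>p\<in>elts f. \<exists>u\<in>elts p. \<exists>c\<in>elts u. p = opair y c \<and> Q c"
      then show "Q (app f y)" using * by auto
    qed
    from this[of "\<lambda>c. P (case_nat c s)"] show ?thesis by simp
  qed
  ultimately show ?thesis unfolding subset_in_def by (simp cong: conj_cong)
qed

end

section \<open>Normal ultrafilters\<close>

lemma fun_on_of_almost_all:
  assumes P: "pdef (\<lambda>s. P (s 0) (s 1))" and U: "\<And>i. i \<in> elts g \<Longrightarrow> almost_all X U (P i)"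
  shows "\<exists>s. fun_on s g \<and> (\<forall>i\<in>elts g. app s i \<in> elts U \<and> elts (app s i) = {x \<in> elts X. P i (x :: 'a::zfc)})"
proof -
  have "\<exists>s. fun_on s g \<and> (\<forall>i\<in>elts g. \<forall>x. x \<in> elts (app s i) \<longleftrightarrow> x \<in> elts X \<and> P i x)"
  proof (rule fun_on_exists)
    show "pdef (\<lambda>s. \<forall>x. x \<in> elts (s 1) \<longleftrightarrow> x \<in> elts X \<and> P (s 0) x)"
      by (intro pdef_intros pdef_comp2[OF P])
    fix i
    obtain v where "elts v = {x \<in> elts X. P i x}"
      using separation_pdef[of "P i" X] pdef_comp2[OF P tdef_const tdef_var] by blast
    then show "\<exists>!v. \<forall>x. x \<in> elts v \<longleftrightarrow> x \<in> elts X \<and> P i x"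
      by (intro ex1I[of _ v]) (auto intro: extensionality)
  qed
  then obtain s where s: "fun_on s g"
    "\<And>i x. i \<in> elts g \<Longrightarrow> x \<in> elts (app s i) \<longleftrightarrow> x \<in> elts X \<and> P i x" by auto
  then have eq: "elts (app s i) = {x \<in> elts X. P i x}" if "i \<in> elts g" for i
    using that by auto
  have "app s i \<in> elts U" if i: "i \<in> elts g" for i
  proof -
    obtain A where "A \<in> elts U" "elts A = {x \<in> elts X. P i x}"
      using U[OF i] unfolding almost_all_def by blast
    then show ?thesis using extensionality[of "app s i" A] eq[OF i] by simp
  qed
  then show ?thesis using s(1) eq by (intro exI[of _ s]) simp
qed

locale normal_ultrapower = ultrapower \<kappa> U M \<pi> for \<kappa> U :: "'a::zfc" and M \<pi> +
  assumes normal: "normal_ultrafilter \<kappa> U"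
    and ord: "ordinal \<kappa>"
begin

abbreviation j :: "'a \<Rightarrow> 'a" where
  "j a \<equiv> \<pi> (const_fun \<kappa> a)"

lemma elts_kappa_subset: "x \<in> elts \<kappa> \<Longrightarrow> elts x \<subseteq> elts \<kappa>"
  using ord unfolding ordinal_def by (elim conjE) (rule bspec)

lemma linear: "x \<in> elts \<kappa> \<Longrightarrow> y \<in> elts \<kappa> \<Longrightarrow> x \<in> elts y \<or> x = y \<or> y \<in> elts x"
  using ord unfolding ordinal_def by meson

lemma U_subset: "A \<in> elts U \<Longrightarrow> elts A \<subseteq> elts \<kappa>"
  using bspec[OF ultrafilter[unfolded ultrafilter_in_def, THEN conjunct2, THEN conjunct2, THEN conjunct1]]
  by (rule conjunct1)

lemma almost_all_mem_iff: "elts A \<subseteq> elts \<kappa> \<Longrightarrow> almost_all \<kappa> U (\<lambda>x. x \<in> elts A) \<longleftrightarrow> A \<in> elts U"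
proof -
  assume "elts A \<subseteq> elts \<kappa>"
  then have "{x \<in> elts \<kappa>. x \<in> elts A} = elts A" by blast
  then show ?thesis unfolding almost_all_def using extensionality by (metis (no_types, lifting))
qed

lemma almost_all_Ball:
  assumes P: "pdef (\<lambda>s. P (s 0) (s 1))" and g: "g \<in> elts \<kappa>"
    and U: "\<And>i. i \<in> elts g \<Longrightarrow> almost_all \<kappa> U (P i)"
  shows "almost_all \<kappa> U (\<lambda>x. \<forall>i\<in>elts g. P i x)"
proof -
  obtain s where s: "fun_on s g" "\<And>i. i \<in> elts g \<Longrightarrow> app s i \<in> elts U"
    "\<And>i. i \<in> elts g \<Longrightarrow> elts (app s i) = {x \<in> elts \<kappa>. P i x}"
    using fun_on_of_almost_all[OF P U] by blast
  have "closed_under_inter_in UNIV g \<kappa> U"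
    using normal g unfolding normal_ultrafilter_def k_complete_ultrafilter_def by blast
  then obtain B where B: "B \<in> elts U" "elts B = {x \<in> elts \<kappa>. \<forall>i\<in>elts g. x \<in> elts (app s i)}"
    unfolding closed_under_inter_in_def using s(1,2) by (meson UNIV_I)
  have "elts B = {x \<in> elts \<kappa>. \<forall>i\<in>elts g. P i x}"
    unfolding B(2) using s(3) by auto
  then show ?thesis unfolding almost_all_def using B(1) by (rule bexI)
qed

lemma almost_all_neq:
  assumes d: "d \<in> elts \<kappa>"
  shows "almost_all \<kappa> U (\<lambda>x. x \<noteq> d)"
proof (rule ccontr)
  have sub: "subset_in UNIV \<kappa> (\<lambda>x. x = d)"
    by (rule subset_in_UNIV) (intro pdef_intros)
  assume "\<not> ?thesis"
  then have "almost_all \<kappa> U (\<lambda>x. x = d)"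
    by (simp add: almost_all_Not[OF ultrafilter sub])
  then obtain A where A: "A \<in> elts U" "elts A = {d}"
    unfolding almost_all_def using d by auto
  have "elts U = {B. elts B \<subseteq> elts \<kappa> \<and> d \<in> elts B}"
  proof (intro set_eqI iffI)
    fix B assume B: "B \<in> elts U"
    obtain C where "C \<in> elts U" "elts C = elts A \<inter> elts B"
      using ultrafilter_Int[OF ultrafilter A(1) B] by blast
    then have "d \<in> elts B" using ultrafilter_nonempty[OF ultrafilter, of C] A(2) by auto
    then show "B \<in> {B. elts B \<subseteq> elts \<kappa> \<and> d \<in> elts B}" using U_subset[OF B] by simp
  next
    fix B assume "B \<in> {B. elts B \<subseteq> elts \<kappa> \<and> d \<in> elts B}"
    then show "B \<in> elts U" using ultrafilter_up[OF ultrafilter A(1), of B] A(2) by simp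
  qed
  moreover have "nonprincipal \<kappa> U"
    using normal unfolding normal_ultrafilter_def by blast
  ultimately show False unfolding nonprincipal_def using d by blast
qed

lemma almost_all_gt:
  assumes d: "d \<in> elts \<kappa>"
  shows "almost_all \<kappa> U (\<lambda>x. d \<in> elts x)"
proof -
  have "almost_all \<kappa> U (\<lambda>x. \<forall>i\<in>elts d. x \<noteq> i)"
    by (rule almost_all_Ball[OF _ d]) (use elts_kappa_subset[OF d] in \<open>auto intro!: pdef_intros almost_all_neq\<close>)
  from almost_all_conj[OF ultrafilter this almost_all_neq[OF d]] show ?thesis
  proof (rule almost_all_mono[OF ultrafilter])
    show "subset_in UNIV \<kappa> (\<lambda>x. d \<in> elts x)"
      by (rule subset_in_UNIV) (intro pdef_intros)
    show "x \<in> elts \<kappa> \<Longrightarrow> (\<forall>i\<in>elts d. x \<noteq> i) \<and> x \<noteq> d \<Longrightarrow> d \<in> elts x" for x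
      using linear[OF d, of x] by blast
  qed
qed

lemma regressive_constant:
  assumes g: "fun_on g \<kappa>" and reg: "almost_all \<kappa> U (\<lambda>x. app g x \<in> elts x)"
  shows "\<exists>c\<in>elts \<kappa>. almost_all \<kappa> U (\<lambda>x. app g x = c)"
proof (rule ccontr)
  assume not: "\<not> ?thesis"
  let ?g = "\<lambda>x. if x \<in> elts \<kappa> then app g x else \<kappa>"
  have sub: "subset_in UNIV \<kappa> (\<lambda>x. app g x = c)" for c
  proof -
    have "subset_in UNIV \<kappa> (\<lambda>x. ?g x = c)"
      by (rule subset_in_UNIV) (intro pdef_eq tdef_app[OF g] tdef_var tdef_const)
    then show ?thesis unfolding subset_in_def by (simp cong: conj_cong)
  qed
  have "almost_all \<kappa> U (\<lambda>x. ?g x \<noteq> c)" if "c \<in> elts \<kappa>" for c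
  proof -
    have "almost_all \<kappa> U (\<lambda>x. app g x \<noteq> c)"
      using not that almost_all_Not[OF ultrafilter sub] by blast
    then show ?thesis by (subst almost_all_cong[where Q = "\<lambda>x. app g x \<noteq> c"]) simp_all
  qed
  then obtain s where s: "fun_on s \<kappa>" "\<And>i. i \<in> elts \<kappa> \<Longrightarrow> app s i \<in> elts U"
    "\<And>i. i \<in> elts \<kappa> \<Longrightarrow> elts (app s i) = {x \<in> elts \<kappa>. ?g x \<noteq> i}"
    using fun_on_of_almost_all[of "\<lambda>c x. ?g x \<noteq> c" \<kappa> \<kappa> U]
      pdef_Not[OF pdef_eq[OF tdef_app[OF g tdef_var[of 1]] tdef_var[of 0]]] by blast
  then obtain D where D: "D \<in> elts U" "elts D = {b \<in> elts \<kappa>. \<forall>a\<in>elts b. b \<in> elts (app s a)}"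
    using normal unfolding normal_ultrafilter_def by meson
  obtain A where A: "A \<in> elts U" "elts A = {x \<in> elts \<kappa>. app g x \<in> elts x}"
    using reg unfolding almost_all_def by blast
  obtain C where C: "C \<in> elts U" "elts C = elts A \<inter> elts D"
    using ultrafilter_Int[OF ultrafilter A(1) D(1)] by blast
  then obtain b where "b \<in> elts A" "b \<in> elts D"
    using ultrafilter_nonempty[OF ultrafilter C(1)] by blast
  then have b: "b \<in> elts \<kappa>" "app g b \<in> elts b" "b \<in> elts (app s (app g b))"
    unfolding A(2) D(2) by auto
  then have "app g b \<in> elts \<kappa>" using elts_kappa_subset by blast
  then show False using b s(3) by simp
qed


text \<open>By normality, every element of the set represented by \<open>x \<mapsto> A \<inter> x\<close> is represented by a
  constant function.\<close>

lemma elts_pi_Int: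
  assumes g: "fun_on g \<kappa>" "\<And>x. x \<in> elts \<kappa> \<Longrightarrow> elts (app g x) = elts A \<inter> elts x"
    and A: "elts A \<subseteq> elts \<kappa>"
  shows "elts (\<pi> g) = j ` elts A"
proof (intro set_eqI iffI)
  fix y assume y: "y \<in> elts (\<pi> g)"
  then obtain h where h: "fun_on h \<kappa>" "y = \<pi> h"
    using pi_surj[OF pi_trans[OF pi_in[OF g(1)]]] by blast
  have "almost_all \<kappa> U (\<lambda>x. app h x \<in> elts (app g x))"
    using y unfolding h(2) pi_mem[OF h(1) g(1)] .
  then have *: "almost_all \<kappa> U (\<lambda>x. app h x \<in> elts A \<and> app h x \<in> elts x)"
    by (subst (asm) almost_all_cong[where Q = "\<lambda>x. app h x \<in> elts A \<and> app h x \<in> elts x"])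
      (simp_all add: g(2))
  obtain k where k: "fun_on k \<kappa>" "\<And>x. x \<in> elts \<kappa> \<Longrightarrow> app k x = x"
    using fun_on_exists_tdef[OF tdef_var, of \<kappa>] by blast
  have "almost_all \<kappa> U (\<lambda>x. app h x \<in> elts x)"
  proof (rule almost_all_mono[OF ultrafilter *])
    have "subset_in UNIV \<kappa> (\<lambda>x. app h x \<in> elts (app k x))"
      using delta0_subset_in[of "\<lambda>s. s 0 \<in> elts (s 1)" "case_nat h (\<lambda>_. k)"] h(1) k(1)
      by (simp add: delta0.Mem split: nat.split)
    then show "subset_in UNIV \<kappa> (\<lambda>x. app h x \<in> elts x)"
      unfolding subset_in_def using k(2) by (simp cong: conj_cong)
  qed blast
  then obtain c where c: "c \<in> elts \<kappa>" "almost_all \<kappa> U (\<lambda>x. app h x = c)"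
    using regressive_constant[OF h(1)] by blast
  have "c \<in> elts A"
  proof (rule ccontr)
    assume "c \<notin> elts A"
    then have "\<not> almost_all \<kappa> U (\<lambda>x. (app h x \<in> elts A \<and> app h x \<in> elts x) \<and> app h x = c)"
      by (intro not_almost_all_False[OF ultrafilter]) blast
    then show False using almost_all_conj[OF ultrafilter * c(2)] by contradiction
  qed
  moreover have "y = j c"
    unfolding h(2) pi_eq[OF h(1) fun_on_const]
    using c(2) by (subst almost_all_cong[where Q = "\<lambda>x. app h x = c"]) (simp_all add: app_const)
  ultimately show "y \<in> j ` elts A" by simp
next
  fix y assume "y \<in> j ` elts A"
  then obtain c where c: "c \<in> elts A" "y = j c" by blast
  then have "almost_all \<kappa> U (\<lambda>x. c \<in> elts x)" using A by (intro almost_all_gt) blast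
  then have "almost_all \<kappa> U (\<lambda>x. app (const_fun \<kappa> c) x \<in> elts (app g x))"
    by (subst almost_all_cong[where Q = "\<lambda>x. c \<in> elts x"]) (simp_all add: app_const g(2) c(1))
  then show "y \<in> elts (\<pi> g)" unfolding c(2) pi_mem[OF fun_on_const g(1)] .
qed

lemma fun_on_Int: "\<exists>g. fun_on g \<kappa> \<and> (\<forall>x\<in>elts \<kappa>. elts (app g x) = elts A \<inter> elts x)"
proof -
  have "\<exists>g. fun_on g \<kappa> \<and> (\<forall>x\<in>elts \<kappa>. \<forall>y. y \<in> elts (app g x) \<longleftrightarrow> y \<in> elts A \<and> y \<in> elts x)"
  proof (rule fun_on_exists)
    show "pdef (\<lambda>s. \<forall>y. y \<in> elts (s 1) \<longleftrightarrow> y \<in> elts A \<and> y \<in> elts (s 0))"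
      by (intro pdef_intros)
    fix x :: 'a
    have "pdef (\<lambda>s. s 0 \<in> elts x)" by (intro pdef_intros)
    then obtain v where v: "elts v = {y \<in> elts A. y \<in> elts x}"
      using separation_pdef[of "\<lambda>y. y \<in> elts x" A] by blast
    show "\<exists>!v. \<forall>y. y \<in> elts v \<longleftrightarrow> y \<in> elts A \<and> y \<in> elts x"
      by (rule ex1I[of _ v]) (auto simp: v intro: extensionality)
  qed
  then show ?thesis by (auto simp: set_eq_iff)
qed

lemma j_fixed: "c \<in> elts \<kappa> \<Longrightarrow> j c = c"
proof (rule ccontr)
  assume c: "c \<in> elts \<kappa>" "j c \<noteq> c"
  let ?R = "\<lambda>f y. f \<in> funs_in UNIV \<kappa> \<and> y = \<pi> f"
  have R: "is_class_rel ?R" using Ult unfolding is_Ult_def by (rule conjunct1)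
  have "pdef (\<lambda>s. \<not> ?R (const_fun \<kappa> (s 0)) (s 0))"
    by (intro pdef_Not pdef_is_class_rel[OF R] tdef_const_fun tdef_var)
  then obtain z where z: "elts z = {x \<in> elts \<kappa>. \<not> ?R (const_fun \<kappa> x) x}"
    using separation_pdef[of "\<lambda>x. \<not> ?R (const_fun \<kappa> x) x" \<kappa>] by blast
  have z: "elts z = {x \<in> elts \<kappa>. j x \<noteq> x}"
    unfolding z funs_in_def using fun_on_const by auto
  then have "elts z \<noteq> {}" using c by blast
  from foundation[OF this] obtain a where a: "a \<in> elts z" "elts a \<inter> elts z = {}" by blast
  then have ak: "a \<in> elts \<kappa>" and neq: "j a \<noteq> a" using z by auto
  have fixed: "j d = d" if "d \<in> elts a" for d
    using that a elts_kappa_subset[OF ak] z by blast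
  obtain g where g: "fun_on g \<kappa>" "\<And>x. x \<in> elts \<kappa> \<Longrightarrow> elts (app g x) = elts a \<inter> elts x"
    using fun_on_Int by blast
  have "\<pi> g = a"
    using elts_pi_Int[OF g elts_kappa_subset[OF ak]] fixed by (intro extensionality) simp
  moreover have "almost_all \<kappa> U (\<lambda>x. \<forall>d\<in>elts a. d \<in> elts x)"
    by (rule almost_all_Ball[OF _ ak]) (use elts_kappa_subset[OF ak] in \<open>auto intro!: pdef_intros almost_all_gt\<close>)
  then have "\<pi> g = j a"
    unfolding pi_eq[OF g(1) fun_on_const]
    by (subst almost_all_cong[where Q = "\<lambda>x. \<forall>d\<in>elts a. d \<in> elts x"])
      (auto simp: app_const g(2) elts_inject[symmetric])
  ultimately show False using neq by simp
qed

lemma pi_Int: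
  assumes "fun_on g \<kappa>" "\<And>x. x \<in> elts \<kappa> \<Longrightarrow> elts (app g x) = elts A \<inter> elts x"
    and "elts A \<subseteq> elts \<kappa>"
  shows "\<pi> g = A"
proof (rule extensionality)
  have "j ` elts A = elts A" using j_fixed assms(3) by force
  then show "elts (\<pi> g) = elts A" using elts_pi_Int[OF assms] by simp
qed

lemma subset_kappa_in: "elts A \<subseteq> elts \<kappa> \<Longrightarrow> A \<in> M"
  using fun_on_Int pi_Int pi_in by metis

lemma kappa_in: "\<kappa> \<in> M"
  by (rule subset_kappa_in) simp

lemma j_in: "j a \<in> M"
  by (rule pi_in[OF fun_on_const])

lemma identity: obtains i where "fun_on i \<kappa>" "\<And>x. x \<in> elts \<kappa> \<Longrightarrow> app i x = x" "\<pi> i = \<kappa>"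
proof -
  obtain i where i: "fun_on i \<kappa>" "\<And>x. x \<in> elts \<kappa> \<Longrightarrow> app i x = x"
    using fun_on_exists_tdef[OF tdef_var, of \<kappa>] by blast
  moreover have "\<pi> i = \<kappa>"
    by (rule pi_Int[OF i(1)]) (use i(2) elts_kappa_subset in auto)
  ultimately show ?thesis by (rule that)
qed

lemma kappa_mem_j_iff: "elts A \<subseteq> elts \<kappa> \<Longrightarrow> \<kappa> \<in> elts (j A) \<longleftrightarrow> A \<in> elts U"
proof -
  assume A: "elts A \<subseteq> elts \<kappa>"
  obtain i where i: "fun_on i \<kappa>" "\<And>x. x \<in> elts \<kappa> \<Longrightarrow> app i x = x" "\<pi> i = \<kappa>"
    using identity by blast
  have "\<kappa> \<in> elts (j A) \<longleftrightarrow> almost_all \<kappa> U (\<lambda>x. app i x \<in> elts (app (const_fun \<kappa> A) x))"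
    using pi_mem[OF i(1) fun_on_const] i(3) by simp
  also have "\<dots> \<longleftrightarrow> almost_all \<kappa> U (\<lambda>x. x \<in> elts A)"
    by (rule almost_all_cong) (simp add: i(2) app_const)
  finally show ?thesis using almost_all_mem_iff[OF A] by simp
qed

lemma kappa_mem_j: "\<kappa> \<in> elts (j \<kappa>)"
  using kappa_mem_j_iff[of \<kappa>] ultrafilter_space[OF ultrafilter] by simp

lemma mem_j_iff: "c \<in> elts \<kappa> \<Longrightarrow> c \<in> elts (j A) \<longleftrightarrow> c \<in> elts A"
proof -
  assume c: "c \<in> elts \<kappa>"
  have "c \<in> elts (j A) \<longleftrightarrow> almost_all \<kappa> U (\<lambda>x. c \<in> elts A)"
    unfolding pi_mem[OF fun_on_const fun_on_const, of c A, unfolded j_fixed[OF c]]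
    by (rule almost_all_cong) (simp add: app_const)
  also have "\<dots> \<longleftrightarrow> c \<in> elts A"
    by (rule almost_all_const[OF ultrafilter])
  finally show ?thesis .
qed

lemma linear_j: "b \<in> elts (j \<kappa>) \<Longrightarrow> b \<in> elts \<kappa> \<or> b = \<kappa> \<or> \<kappa> \<in> elts b"
proof -
  obtain i where i: "fun_on i \<kappa>" "\<And>x. x \<in> elts \<kappa> \<Longrightarrow> app i x = x" "\<pi> i = \<kappa>"
    using identity by blast
  let ?P = "\<lambda>s :: nat \<Rightarrow> 'a. \<forall>b\<in>elts (s 0). b \<in> elts (s (Suc 0)) \<or> b = s (Suc 0) \<or> s (Suc 0) \<in> elts b"
  let ?f = "case_nat (const_fun \<kappa> \<kappa>) (\<lambda>_. i)"
  have "delta0 ?P" by (intro delta0_intros)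
  moreover have "fun_on (?f n) \<kappa>" for n by (cases n) (simp_all add: fun_on_const i(1))
  ultimately have "?P (\<lambda>n. \<pi> (?f n)) \<longleftrightarrow> almost_all \<kappa> U (\<lambda>x. ?P (\<lambda>n. app (?f n) x))"
    by (rule Los)
  moreover have "almost_all \<kappa> U (\<lambda>x. ?P (\<lambda>n. app (?f n) x))"
    by (rule almost_all_True[OF ultrafilter]) (use linear in \<open>auto simp: app_const i(2)\<close>)
  ultimately have "\<forall>b\<in>elts (j \<kappa>). b \<in> elts \<kappa> \<or> b = \<kappa> \<or> \<kappa> \<in> elts b" by (simp add: i(3))
  then show "b \<in> elts (j \<kappa>) \<Longrightarrow> b \<in> elts \<kappa> \<or> b = \<kappa> \<or> \<kappa> \<in> elts b" by blast
qed

end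

section \<open>Comparison of normal ultrafilters\<close>

locale iterated_ultrapower = normal_ultrapower +
  fixes Y W :: 'a and N :: "'a set" and \<rho> :: "'a \<Rightarrow> 'a"
  assumes W: "ultrafilter_in M Y W"
    and Ult_W: "is_Ult M Y W N \<rho>"
begin

abbreviation k :: "'a \<Rightarrow> 'a" where
  "k a \<equiv> \<rho> (const_fun Y a)"

lemma Y_in: "Y \<in> M" and W_in: "W \<in> M"
  using W unfolding ultrafilter_in_def by simp_all

lemma rho_mem: "\<lbrakk>f \<in> M; fun_on f Y; g \<in> M; fun_on g Y\<rbrakk> \<Longrightarrow>
    \<rho> f \<in> elts (\<rho> g) \<longleftrightarrow> almost_all Y W (\<lambda>y. app f y \<in> elts (app g y))"
  and rho_eq: "\<lbrakk>f \<in> M; fun_on f Y; g \<in> M; fun_on g Y\<rbrakk> \<Longrightarrow>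
    \<rho> f = \<rho> g \<longleftrightarrow> almost_all Y W (\<lambda>y. app f y = app g y)"
  using Ult_W unfolding is_Ult_def funs_in_def by simp_all

lemma rho_in: "f \<in> M \<Longrightarrow> fun_on f Y \<Longrightarrow> \<rho> f \<in> N"
  and rho_surj: "y \<in> N \<Longrightarrow> \<exists>f\<in>M. fun_on f Y \<and> y = \<rho> f"
  and N_trans: "x \<in> N \<Longrightarrow> elts x \<subseteq> N"
proof -
  have *: "\<rho> ` {f \<in> M. fun_on f Y} = N"
    using Ult_W unfolding is_Ult_def funs_in_def by simp
  show "f \<in> M \<Longrightarrow> fun_on f Y \<Longrightarrow> \<rho> f \<in> N"
    unfolding *[symmetric] by (rule imageI) simp
  show "y \<in> N \<Longrightarrow> \<exists>f\<in>M. fun_on f Y \<and> y = \<rho> f"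
    unfolding *[symmetric] by blast
  show "x \<in> N \<Longrightarrow> elts x \<subseteq> N"
    using Ult_W unfolding is_Ult_def by simp
qed

lemma k_in: "a \<in> M \<Longrightarrow> k a \<in> N"
  by (rule rho_in[OF Ult_const_fun[OF Y_in] fun_on_const])

lemma rho_mem_k: "\<lbrakk>f \<in> M; fun_on f Y; b \<in> M\<rbrakk> \<Longrightarrow> \<rho> f \<in> elts (k b) \<longleftrightarrow> almost_all Y W (\<lambda>y. app f y \<in> elts b)"
  by (subst rho_mem) (auto simp: Ult_const_fun Y_in fun_on_const app_const intro!: almost_all_cong)

lemma k_mem_rho: "\<lbrakk>f \<in> M; fun_on f Y; b \<in> M\<rbrakk> \<Longrightarrow> k b \<in> elts (\<rho> f) \<longleftrightarrow> almost_all Y W (\<lambda>y. b \<in> elts (app f y))"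
  by (subst rho_mem) (auto simp: Ult_const_fun Y_in fun_on_const app_const intro!: almost_all_cong)

lemma rho_eq_k: "\<lbrakk>f \<in> M; fun_on f Y; b \<in> M\<rbrakk> \<Longrightarrow> \<rho> f = k b \<longleftrightarrow> almost_all Y W (\<lambda>y. app f y = b)"
  by (subst rho_eq) (auto simp: Ult_const_fun Y_in fun_on_const app_const intro!: almost_all_cong)

lemma k_mem_iff: "a \<in> M \<Longrightarrow> b \<in> M \<Longrightarrow> k a \<in> elts (k b) \<longleftrightarrow> a \<in> elts b"
proof -
  assume ab: "a \<in> M" "b \<in> M"
  have "k a \<in> elts (k b) \<longleftrightarrow> almost_all Y W (\<lambda>y. app (const_fun Y a) y \<in> elts b)"
    by (rule rho_mem_k[OF Ult_const_fun[OF Y_in ab(1)] fun_on_const ab(2)])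
  also have "\<dots> \<longleftrightarrow> almost_all Y W (\<lambda>y. a \<in> elts b)"
    by (rule almost_all_cong) (simp add: app_const)
  also have "\<dots> \<longleftrightarrow> a \<in> elts b"
    by (rule almost_all_const[OF W])
  finally show ?thesis .
qed

lemma U_iff: "elts A \<subseteq> elts \<kappa> \<Longrightarrow> A \<in> elts U \<longleftrightarrow> k \<kappa> \<in> elts (k (j A))"
  by (simp add: k_mem_iff[OF kappa_in j_in] kappa_mem_j_iff)

lemma linear_k_kappa:
  assumes b: "b \<in> elts (k (j \<kappa>))"
  shows "b \<in> elts (k \<kappa>) \<or> b = k \<kappa> \<or> k \<kappa> \<in> elts b"
proof (rule ccontr)
  assume not: "\<not> ?thesis"
  have "b \<in> N" using N_trans[OF k_in[OF j_in]] b by blast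
  then obtain f where f: "f \<in> M" "fun_on f Y" "b = \<rho> f" using rho_surj by blast
  have sub: "subset_in M Y (\<lambda>y. app f y \<in> elts \<kappa>)" "subset_in M Y (\<lambda>y. app f y = \<kappa>)"
    "subset_in M Y (\<lambda>y. \<kappa> \<in> elts (app f y))"
    using Ult_subset_in_app[OF delta0.Mem[of 0 1], of "\<lambda>_. \<kappa>" f Y]
      Ult_subset_in_app[OF delta0.Eq[of 0 1], of "\<lambda>_. \<kappa>" f Y]
      Ult_subset_in_app[OF delta0.Mem[of 1 0], of "\<lambda>_. \<kappa>" f Y]
    by (simp_all add: kappa_in f Y_in)
  have "almost_all Y W (\<lambda>y. app f y \<notin> elts \<kappa>)" "almost_all Y W (\<lambda>y. app f y \<noteq> \<kappa>)"
    "almost_all Y W (\<lambda>y. \<kappa> \<notin> elts (app f y))"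
    using not unfolding f(3) rho_mem_k[OF f(1,2) kappa_in] rho_eq_k[OF f(1,2) kappa_in]
      k_mem_rho[OF f(1,2) kappa_in]
    by (simp_all add: almost_all_Not[OF W] sub)
  moreover have "almost_all Y W (\<lambda>y. app f y \<in> elts (j \<kappa>))"
    using b unfolding f(3) rho_mem_k[OF f(1,2) j_in] .
  ultimately have "almost_all Y W (\<lambda>y. app f y \<in> elts (j \<kappa>) \<and>
      app f y \<notin> elts \<kappa> \<and> app f y \<noteq> \<kappa> \<and> \<kappa> \<notin> elts (app f y))" (is "almost_all Y W ?Q")
    by (intro almost_all_conj[OF W])
  moreover have "\<not> almost_all Y W ?Q"
    by (rule not_almost_all_False[OF W]) (use linear_j in blast)
  ultimately show False by contradiction
qed

text \<open>The ultrafilter derived from \<open>a\<close> below \<open>k \<kappa>\<close> consists of the subsets of \<open>\<kappa>\<close> whose preimage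
  under a representative of \<open>a\<close> belongs to \<open>W\<close>. This is a bounded condition with parameters in
  \<open>M\<close>.\<close>

lemma derived_in:
  assumes a: "a \<in> elts (k \<kappa>)"
    and D: "\<And>A. A \<in> elts D \<longleftrightarrow> elts A \<subseteq> elts \<kappa> \<and> a \<in> elts (k (j A))"
  shows "D \<in> M"
proof -
  have "a \<in> N" using N_trans[OF k_in[OF kappa_in]] a by blast
  then obtain f where f: "f \<in> M" "fun_on f Y" "a = \<rho> f" using rho_surj by blast
  have fk: "almost_all Y W (\<lambda>y. app f y \<in> elts \<kappa>)"
    using a unfolding f(3) rho_mem_k[OF f(1,2) kappa_in] .
  let ?s = "case_nat \<kappa> (case_nat Y (case_nat W (\<lambda>_. f)))"
  let ?B = "\<lambda>b y f. \<exists>c\<in>elts b. \<exists>p\<in>elts f. p = opair y c"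
  let ?P = "\<lambda>s. elts (s 0) \<subseteq> elts (s 1) \<and> (\<exists>C\<in>elts (s 3).
    (\<forall>y\<in>elts C. y \<in> elts (s 2) \<and> ?B (s 0) y (s 4)) \<and>
    (\<forall>y\<in>elts (s 2). ?B (s 0) y (s 4) \<longrightarrow> y \<in> elts C))"
  have "\<exists>v\<in>M. elts v = {b \<in> M. ?P (case_nat b ?s)}"
  proof (rule Ult_collect)
    show "delta0 ?P" by (intro delta0_intros delta0_subset delta0_opair)
    show "?s i \<in> M" for i
      by (auto simp: kappa_in Y_in W_in f split: nat.split)
    show "\<exists>v. \<forall>b. ?P (case_nat b s) \<longrightarrow> b \<in> elts v" for s :: "nat \<Rightarrow> 'a"
    proof -
      obtain v where v: "elts v = {y. elts y \<subseteq> elts (s 0)}" using powerset by blast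
      show ?thesis by (rule exI[of _ v]) (simp add: v)
    qed
  qed
  then obtain v where v: "v \<in> M" "elts v = {b \<in> M. ?P (case_nat b ?s)}" by blast
  have B: "?B b y f \<longleftrightarrow> app f y \<in> elts b" if "y \<in> elts Y" for b y
    using app_equality[OF f(2) that] by auto
  have P: "?P (case_nat b ?s) \<longleftrightarrow> elts b \<subseteq> elts \<kappa> \<and> almost_all Y W (\<lambda>y. app f y \<in> elts b)" for b
  proof -
    have "(\<exists>C\<in>elts W. (\<forall>y\<in>elts C. y \<in> elts Y \<and> ?B b y f) \<and> (\<forall>y\<in>elts Y. ?B b y f \<longrightarrow> y \<in> elts C)) \<longleftrightarrow>
        (\<exists>C\<in>elts W. elts C = {y \<in> elts Y. ?B b y f})"
      by (intro bex_cong refl) blast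
    also have "\<dots> \<longleftrightarrow> almost_all Y W (\<lambda>y. app f y \<in> elts b)"
      unfolding almost_all_def using B by (simp cong: conj_cong)
    finally show ?thesis by (simp add: eval_nat_numeral)
  qed
  have "almost_all Y W (\<lambda>y. app f y \<in> elts b) \<longleftrightarrow> a \<in> elts (k (j b))" if b: "elts b \<subseteq> elts \<kappa>" for b
  proof -
    have sub: "subset_in M Y (\<lambda>y. app f y \<in> elts c)" if "c \<in> M" for c
      using Ult_subset_in_app[OF delta0.Mem[of 0 1], of "\<lambda>_. c" f Y] by (simp add: that f Y_in)
    have "almost_all Y W (\<lambda>y. app f y \<in> elts b) \<longleftrightarrow> almost_all Y W (\<lambda>y. app f y \<in> elts (j b))"
    proof
      assume "almost_all Y W (\<lambda>y. app f y \<in> elts b)"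
      then show "almost_all Y W (\<lambda>y. app f y \<in> elts (j b))"
        by (rule almost_all_mono[OF W _ sub[OF j_in]]) (use mem_j_iff b in blast)
    next
      assume "almost_all Y W (\<lambda>y. app f y \<in> elts (j b))"
      from almost_all_conj[OF W this fk] show "almost_all Y W (\<lambda>y. app f y \<in> elts b)"
        by (rule almost_all_mono[OF W _ sub[OF subset_kappa_in[OF b]]]) (use mem_j_iff in blast)
    qed
    then show ?thesis unfolding f(3) rho_mem_k[OF f(1,2) j_in] .
  qed
  then have "v = D"
    by (intro extensionality set_eqI) (use D subset_kappa_in in \<open>auto simp only: v(2) P mem_Collect_eq\<close>)
  then show ?thesis using v(1) by simp
qed

end

theorem theorem3p11:
  fixes \<kappa> U0 U1 :: "'a::zfc"
  assumes "ultrapower_axiom TYPE('a)"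
    and "measurable_cardinal \<kappa>"
    and "normal_ultrafilter \<kappa> U0"
    and "normal_ultrafilter \<kappa> U1"
  shows "U0 = U1 \<or> in_Ult U0 \<kappa> U1 \<or> in_Ult U1 \<kappa> U0"
proof -
  have kappa: "omega \<in> elts \<kappa>" "ordinal \<kappa>"
    using assms(2) unfolding measurable_cardinal_def cardinal_def by blast+
  have uf: "ultrafilter_in UNIV \<kappa> U" "cc_ultrafilter_in UNIV \<kappa> U" if "normal_ultrafilter \<kappa> U" for U
    using that kappa(1)
    unfolding normal_ultrafilter_def k_complete_ultrafilter_def cc_ultrafilter_in_def by simp_all
  obtain Y0 W0 Y1 W1 where "is_comparison \<kappa> U0 \<kappa> U1 Y0 W0 Y1 W1"
    using assms(1) uf(2)[OF assms(3)] uf(2)[OF assms(4)] unfolding ultrapower_axiom_def by meson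
  then obtain M0 \<pi>0 M1 \<pi>1 N \<rho>0 \<rho>1 where
    M: "is_Ult UNIV \<kappa> U0 M0 \<pi>0" "is_Ult UNIV \<kappa> U1 M1 \<pi>1"
    and W: "cc_ultrafilter_in M0 Y0 W0" "cc_ultrafilter_in M1 Y1 W1"
    and N: "is_Ult M0 Y0 W0 N \<rho>0" "is_Ult M1 Y1 W1 N \<rho>1"
    and comm: "\<And>a. ult_emb Y0 \<rho>0 (ult_emb \<kappa> \<pi>0 a) = ult_emb Y1 \<rho>1 (ult_emb \<kappa> \<pi>1 a)"
    unfolding is_comparison_def by blast
  interpret I0: iterated_ultrapower \<kappa> U0 M0 \<pi>0 Y0 W0 N \<rho>0
    by unfold_locales (use assms(3) uf kappa M W N in \<open>simp_all add: cc_ultrafilter_in_def\<close>)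
  interpret I1: iterated_ultrapower \<kappa> U1 M1 \<pi>1 Y1 W1 N \<rho>1
    by unfold_locales (use assms(4) uf kappa M W N in \<open>simp_all add: cc_ultrafilter_in_def\<close>)
  have comm: "I0.k (I0.j a) = I1.k (I1.j a)" for a
    using comm unfolding ult_emb_def .
  have U0: "A \<in> elts U0 \<longleftrightarrow> elts A \<subseteq> elts \<kappa> \<and> I0.k \<kappa> \<in> elts (I0.k (I0.j A))" for A
    using I0.U_subset I0.U_iff by blast
  have U1: "A \<in> elts U1 \<longleftrightarrow> elts A \<subseteq> elts \<kappa> \<and> I1.k \<kappa> \<in> elts (I1.k (I1.j A))" for A
    using I1.U_subset I1.U_iff by blast
  have "I1.k \<kappa> \<in> elts (I0.k (I0.j \<kappa>))"
    unfolding comm I1.k_mem_iff[OF I1.kappa_in I1.j_in] by (rule I1.kappa_mem_j)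
  then consider "I1.k \<kappa> \<in> elts (I0.k \<kappa>)" | "I1.k \<kappa> = I0.k \<kappa>" | "I0.k \<kappa> \<in> elts (I1.k \<kappa>)"
    using I0.linear_k_kappa by blast
  then show ?thesis
  proof cases
    case 1
    then have "U1 \<in> M0" by (rule I0.derived_in) (simp add: U1 comm)
    then show ?thesis using M(1) unfolding in_Ult_def by blast
  next
    case 2
    then have "U0 = U1" by (intro extensionality set_eqI) (simp add: U0 U1 comm)
    then show ?thesis by simp
  next
    case 3
    then have "U0 \<in> M1" by (rule I1.derived_in) (simp add: U0 comm)
    then show ?thesis using M(2) unfolding in_Ult_def by blast
  qed
qed

end
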